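(* Let $$p(x) = \frac{\pi^2}{4} \left[ 1 - \lambda^2 \sin^2\!\left(\frac{\pi x}{2}\right) + 2\lambda \frac{ \sin^2(\pi x /2) } { \cos(\pi x /2) } - \lambda \cos\!\left(\frac{\pi x}{2}\right) \right]$$ and let the real number $\lambda$ satisfy $$0 \le \lambda \le \lambda_0 = \frac{1}{\pi^2} \left[ \left( 4 + \frac{5}{4} \pi^2 \right) - \left( \Big( 4 + \frac{5}{4} \pi^2 \Big)^2 - 8 \pi^2 \right)^{1/2} \right] = 0.2664\ldots$$ Then $p(z)$ is self majorant, and if $f$ is an analytic function in $\Delta$ satisfying $$| Sf(z) | \le 2 p( |z| ) , \qquad z \in \Delta ,$$ then $f$ is univalent in $\Delta$, and the univalence criterion $|Sf(z)|\le 2p(|z|)$, $z\in\Delta$, is sharp.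
   Context: $\Delta=\{z\in\mathbb{C}: |z|<1\}$ is the open unit disc. For an analytic locally univalent function $f$, the Schwarzian derivative is $Sf = \left(\frac{f''}{f'}\right)' - \frac12\left(\frac{f''}{f'}\right)^2$; a hypothesis on $Sf$ in $\Delta$ presupposes that $f$ is locally univalent in $\Delta$. Univalent means injective. The formula for $p$ is also used for complex argument $z\in\Delta$. An analytic function $p$ on $\Delta$ is called self majorant in $\Delta$ if $|p(z)|\le p(|z|)$ for all $z\in\Delta$. The univalence criterion $|Sf(z)|\le 2p(|z|)$, $z\in\Delta$, is called sharp if, for analytic (locally univalent) $f$ in $\Delta$, the conditions $Sf(x)\ge 2p(x)$ for $-1<x<1$ (in particular $Sf(x)$ is real there) and $Sf(z)\not\equiv 2p(z)$ imply that $f$ is not univalent in $\Delta$.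
   Formalization: The printed decimal value 0.2664… of λ₀ is incorrect: the closed form evaluates to 0.26625…; λ₀ is taken to be the closed form, and the decimal value is not asserted. *)

theory Defs
  imports "HOL-Complex_Analysis.Complex_Analysis"
begin

definition schwarzian :: "(complex \<Rightarrow> complex) \<Rightarrow> complex \<Rightarrow> complex" where
  "schwarzian f z =
     deriv (\<lambda>w. deriv (deriv f) w / deriv f w) z - 1 / 2 * (deriv (deriv f) z / deriv f z)\<^sup>2"

definition locally_univalent_on :: "(complex \<Rightarrow> complex) \<Rightarrow> complex set \<Rightarrow> bool" where
  "locally_univalent_on f S \<longleftrightarrow>
     f analytic_on S \<and> (\<forall>z\<in>S. \<exists>U. open U \<and> z \<in> U \<and> U \<subseteq> S \<and> inj_on f U)"

text \<open>Polymorphic, so that one formula serves both for real arguments (with real values) and for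
  complex arguments.\<close>

definition nehari_p :: "real \<Rightarrow> 'a \<Rightarrow> 'a::{real_normed_field,banach}" where
  "nehari_p l x = of_real (pi\<^sup>2 / 4) *
     (1 - of_real (l\<^sup>2) * (sin (of_real pi * x / 2))\<^sup>2
        + of_real (2 * l) * ((sin (of_real pi * x / 2))\<^sup>2 / cos (of_real pi * x / 2))
        - of_real l * cos (of_real pi * x / 2))"

lemma nehari_p_real:
  fixes x :: real
  shows "nehari_p l x = pi\<^sup>2 / 4 *
     (1 - l\<^sup>2 * (sin (pi * x / 2))\<^sup>2 + 2 * l * ((sin (pi * x / 2))\<^sup>2 / cos (pi * x / 2))
        - l * cos (pi * x / 2))"
  by (simp add: nehari_p_def)

lemma nehari_p_of_real: "nehari_p l (complex_of_real x) = complex_of_real (nehari_p l x)"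
proof -
  have arg: "of_real pi * complex_of_real x / 2 = complex_of_real (pi * x / 2)"
    by simp
  show ?thesis
    unfolding nehari_p_def arg sin_of_real cos_of_real by simp
qed

definition lambda0 :: real where
  "lambda0 = 1 / pi\<^sup>2 * ((4 + 5 / 4 * pi\<^sup>2) - sqrt ((4 + 5 / 4 * pi\<^sup>2)\<^sup>2 - 8 * pi\<^sup>2))"

text \<open>The value of \<open>p\<close> at the real point \<open>|z|\<close> is required to be real, so that the
  inequality makes sense.\<close>

definition self_majorant :: "(complex \<Rightarrow> complex) \<Rightarrow> bool" where
  "self_majorant p \<longleftrightarrow>
     p analytic_on ball 0 1 \<and>
     (\<forall>z\<in>ball 0 1. p (of_real (cmod z)) \<in> \<real> \<and> cmod (p z) \<le> Re (p (of_real (cmod z))))"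

text \<open>Sharpness of the criterion \<open>|Sf(z)| \<le> 2 p(|z|)\<close>, for a \<open>p\<close> that is real on \<open>(-1,1)\<close>.\<close>

definition sharp_univalence_criterion :: "(complex \<Rightarrow> complex) \<Rightarrow> bool" where
  "sharp_univalence_criterion p \<longleftrightarrow>
     (\<forall>f. locally_univalent_on f (ball 0 1) \<longrightarrow>
        (\<forall>x::real. -1 < x \<and> x < 1 \<longrightarrow>
           schwarzian f (of_real x) \<in> \<real> \<and>
           Re (schwarzian f (of_real x)) \<ge> 2 * Re (p (of_real x))) \<longrightarrow>
        (\<exists>z\<in>ball 0 1. schwarzian f z \<noteq> 2 * p z) \<longrightarrow>
        \<not> inj_on f (ball 0 1))"

end

theory Submission imports Defs begin

text \<open>
  Put \<open>y x = cos (pi x / 2) * exp (- l * cos (pi x / 2))\<close>. It is positive on \<open>(-1, 1)\<close>, solves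
  \<open>y'' + p y = 0\<close> and vanishes linearly at both ends of the interval; \<open>p\<close> is found by dividing
  \<open>- y''\<close> by \<open>y\<close>. Everything about univalence follows by comparing other linear equations
  with this one.

  The link is the classical linearization: if \<open>r\<^sup>2 f' = 1\<close>, then \<open>r\<close> and \<open>f r\<close> span the solutions
  of \<open>w'' + (Sf / 2) w = 0\<close> (\<open>schwarzian_linearization\<close>). Hence \<open>f\<close> takes the same value at two
  points exactly when a nontrivial solution vanishes at both.

  For the criterion, suppose that \<open>f\<close> identifies two points. They lie on a hyperbolic geodesic, which
  up to a rotation is the image of \<open>(-1, 1)\<close> under a disc automorphism \<open>T\<close> with \<open>T 0\<close> on the imaginary
  axis. Pulling the linear equation back along \<open>T\<close> gives an equation on \<open>(-1, 1)\<close> with a potential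
  \<open>Q\<close>. Since \<open>\<bar>T x\<bar> \<ge> \<bar>x\<bar>\<close> and \<open>(1 - x\<^sup>2)\<^sup>2 p(x)\<close> decreases on \<open>[0, 1)\<close>, the bound on \<open>Sf\<close> becomes
  \<open>Re Q \<le> p\<close>, and then a solution vanishing twice contradicts the positivity of \<open>y\<close>
  (\<open>vanishing_twice_below_riccati\<close>). The monotonicity is where the bound on \<open>l\<close> enters: to
  second order at \<open>x = 0\<close> it is equivalent to the quadratic inequality solved by \<open>lambda0\<close>
  (\<open>lambda_quadratic\<close>), and the inequality \<open>(1 - x\<^sup>2) tan (pi x / 2) \<le> pi x / 2\<close> shows that this
  local condition suffices (\<open>nehari_weight_antimono\<close>).

  For sharpness, let \<open>Sf \<ge> 2 p\<close> on \<open>(-1, 1)\<close>. If \<open>Sf\<close> and \<open>2 p\<close> differ somewhere, they differ at a real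
  point \<open>x0\<close>, by the identity theorem. The real solution with the Cauchy data of \<open>y\<close> at \<open>x0\<close> then
  drops below \<open>y\<close> on both sides, and because the integral of \<open>1 / y\<^sup>2\<close> diverges at both ends it must
  vanish on either side of \<open>x0\<close> (\<open>solution_vanishes_before_endpoint\<close>).

  Finally \<open>p\<close> is self majorant because its Taylor coefficients are nonnegative. In
  \<open>p = pi\<^sup>2/4 * (1 + l (2 sec - 3 cos) - l\<^sup>2 sin\<^sup>2)\<close> the coefficients of \<open>sec\<close>, given by the
  Euler numbers, are large enough to absorb the negative ones (\<open>euler_number_lower_bound\<close>).
\<close>

section \<open>Monotonicity of the weighted majorant\<close>

text \<open>
  With \<open>t = pi x / 2\<close> this is the Becker--Stark bound \<open>(1 - x\<^sup>2) tan (pi x / 2) \<le> pi x / 2\<close>. The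
  difference \<open>D\<close> of the two sides vanishes at \<open>0\<close> and at \<open>pi / 2\<close>, and \<open>D' t = t * E t\<close> with \<open>E 0 = 0\<close>
  and \<open>E'\<close> decreasing. A negative value of \<open>D\<close> would force \<open>E\<close> to be first negative and later
  positive, so \<open>E'\<close> would pass from a negative to a positive value.
\<close>
lemma becker_stark_upper:
  fixes t :: real
  assumes "0 \<le> t" "t < pi/2"
  shows "(1 - 4 / pi\<^sup>2 * t\<^sup>2) * sin t \<le> t * cos t"
proof (rule ccontr)
  define k :: real where "k = 4 / pi\<^sup>2"
  have k0: "0 < k" and kpi: "k * (pi/2)\<^sup>2 = 1" by (simp_all add: k_def power2_eq_square)
  define D where "D = (\<lambda>t::real. t * cos t - (1 - k * t\<^sup>2) * sin t)"
  define E where "E = (\<lambda>t::real. k * t * cos t - (1 - 2 * k) * sin t)"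
  define E' where "E' = (\<lambda>t::real. (3 * k - 1) * cos t - k * (t * sin t))"
  have dD: "(D has_real_derivative t * E t) (at t)" for t
    unfolding D_def E_def by (auto intro!: derivative_eq_intros simp: algebra_simps power2_eq_square)
  have dE: "(E has_real_derivative E' t) (at t)" for t
    unfolding E_def E'_def by (auto intro!: derivative_eq_intros simp: algebra_simps power2_eq_square)
  assume "\<not> ?thesis"
  then have neg: "D t < 0" by (simp add: D_def k_def)
  have D0: "D 0 = 0" and D1: "D (pi/2) = 0" using kpi by (simp_all add: D_def)
  have "t \<noteq> 0" using neg D0 by auto
  with assms have t: "0 < t" by simp
  obtain b where b: "0 < b" "b < t" "D t - D 0 = (t - 0) * (b * E b)"
    using MVT2[OF t, of D "\<lambda>t. t * E t"] dD by blast
  have Eb: "E b < 0"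
  proof -
    have "(t * b) * E b < 0" using b neg D0 by (simp add: mult.assoc)
    then show ?thesis using t b by (simp add: mult_less_0_iff)
  qed
  obtain c where c: "t < c" "c < pi/2" "D (pi/2) - D t = (pi/2 - t) * (c * E c)"
    using MVT2[OF assms(2), of D "\<lambda>t. t * E t"] dD by blast
  have Ec: "E c > 0"
  proof -
    have "((pi/2 - t) * c) * E c > 0" using c neg D1 by (simp add: mult.assoc)
    moreover have "(pi/2 - t) * c > 0" using c t by simp
    ultimately show ?thesis by (simp add: zero_less_mult_iff)
  qed
  obtain b' where b': "0 < b'" "b' < b" "E b - E 0 = (b - 0) * E' b'"
    using MVT2[OF b(1), of E E'] dE by blast
  have bc: "b < c" using b c by simp
  obtain c' where c': "b < c'" "c' < c" "E c - E b = (c - b) * E' c'"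
    using MVT2[OF bc, of E E'] dE by blast
  have "E' b' < 0" using b' b Eb by (simp add: E_def mult_less_0_iff zero_less_mult_iff)
  moreover have "E' c' > 0"
  proof -
    have "(c - b) * E' c' > 0" using c' Eb Ec by simp
    then show ?thesis using bc by (simp add: zero_less_mult_iff)
  qed
  moreover have "E' c' \<le> E' b'"
  proof -
    have "pi\<^sup>2 \<le> 12"
      using power_mono[of pi "3.2::real" 2] pi_approx by (simp add: power2_eq_square)
    then have k: "3 * k - 1 \<ge> 0" by (simp add: k_def)
    have "cos c' \<le> cos b'" using b' c' c by (intro cos_monotone_0_pi_le) auto
    then have 1: "(3 * k - 1) * cos c' \<le> (3 * k - 1) * cos b'"
      using k by (intro mult_left_mono) auto
    have "sin b' \<le> sin c'" using b' c' c by (intro sin_monotone_2pi_le) auto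
    moreover have "0 \<le> sin b'" using b' c' c by (intro sin_ge_zero) auto
    ultimately have "b' * sin b' \<le> c' * sin c'" using b' c' by (intro mult_mono) auto
    then have "k * (b' * sin b') \<le> k * (c' * sin c')" using k0 by (intro mult_left_mono) auto
    with 1 show ?thesis unfolding E'_def by linarith
  qed
  ultimately show False by linarith
qed


lemma pi_squared_bounds: "9 < pi\<^sup>2" "pi\<^sup>2 < 10"
  using power_strict_mono[of 3 pi 2] pi_gt3 power_mono[of pi "3.15" 2] pi_approx
  by (auto simp: power2_eq_square)

text \<open>
  The number \<open>lambda0\<close> is the smaller root of
  \<open>pi\<^sup>2 l\<^sup>2 - 2 (4 + 5/4 pi\<^sup>2) l + 8 = 0\<close>; the second inequality says that this quadratic is
  nonnegative. It is the condition that the coefficient of \<open>x\<^sup>2\<close> in \<open>(1 - x\<^sup>2)\<^sup>2 p(x)\<close> is at most \<open>0\<close>.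
\<close>
lemma lambda_range:
  assumes "0 \<le> l" "l \<le> lambda0"
  shows lambda_le_half: "l \<le> 1/2"
    and lambda_quadratic: "l * (5/4 * pi\<^sup>2 + 4 - l * (pi\<^sup>2 / 2)) \<le> 4"
proof -
  define A where "A = 4 + 5/4 * pi\<^sup>2"
  define R where "R = sqrt (A\<^sup>2 - 8 * pi\<^sup>2)"
  have A: "15 \<le> A" using pi_squared_bounds by (simp add: A_def)
  have "15\<^sup>2 \<le> A\<^sup>2" using A by (intro power_mono) auto
  then have pos: "0 \<le> A\<^sup>2 - 8 * pi\<^sup>2" using pi_squared_bounds by simp
  then have R0: "0 \<le> R" and R2: "R\<^sup>2 = A\<^sup>2 - 8 * pi\<^sup>2" by (simp_all add: R_def)
  have l0: "pi\<^sup>2 * lambda0 = A - R" by (simp add: lambda0_def A_def R_def)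
  have "(A - pi\<^sup>2/2)\<^sup>2 \<le> A\<^sup>2 - 8 * pi\<^sup>2"
  proof -
    have "A\<^sup>2 - 8 * pi\<^sup>2 - (A - pi\<^sup>2/2)\<^sup>2 = pi\<^sup>2 * (A - 8 - pi\<^sup>2/4)"
      by (simp add: power2_eq_square algebra_simps)
    also have "\<dots> \<ge> 0" using pi_squared_bounds by (intro mult_nonneg_nonneg) (auto simp: A_def)
    finally show ?thesis by simp
  qed
  then have "A - pi\<^sup>2/2 \<le> R" unfolding R_def by (rule real_le_rsqrt)
  with l0 have "pi\<^sup>2 * lambda0 \<le> pi\<^sup>2 * (1/2)" by simp
  then have "lambda0 \<le> 1/2" by (subst (asm) mult_le_cancel_left_pos) auto
  with assms show half: "l \<le> 1/2" by simp
  have le: "pi\<^sup>2 * l \<le> A - R" using assms(2) l0[symmetric] by (simp add: mult_left_mono)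
  have "R\<^sup>2 \<le> (A - pi\<^sup>2 * l)\<^sup>2" using le R0 by (intro power_mono) auto
  then have "0 \<le> pi\<^sup>2 * (8 - 2 * A * l + pi\<^sup>2 * l\<^sup>2)"
    unfolding R2 by (simp add: power2_eq_square algebra_simps)
  then have "0 \<le> 8 - 2 * A * l + pi\<^sup>2 * l\<^sup>2" by (simp add: zero_le_mult_iff)
  then show "l * (5/4 * pi\<^sup>2 + 4 - l * (pi\<^sup>2 / 2)) \<le> 4"
    unfolding A_def by (simp add: power2_eq_square algebra_simps)
qed

lemma cos_half_pi_pos: "\<bar>x\<bar> < 1 \<Longrightarrow> 0 < cos (pi * x / 2)"
  using mult_strict_left_mono[of x 1 pi] mult_strict_left_mono[of "-1" x pi]
  by (intro cos_gt_zero_pi) (auto simp: abs_mult abs_less_iff)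

lemma nehari_p_alt:
  fixes x :: real
  assumes "\<bar>x\<bar> < 1"
  shows "nehari_p l x = pi\<^sup>2 / 4 * (1 + l * (2 / cos (pi * x / 2) - 3 * cos (pi * x / 2))
                          - l\<^sup>2 * (sin (pi * x / 2))\<^sup>2)"
proof -
  have "cos (pi * x / 2) \<noteq> 0" using cos_half_pi_pos[OF assms] by simp
  then have "(sin (pi * x / 2))\<^sup>2 / cos (pi * x / 2) = 1 / cos (pi * x / 2) - cos (pi * x / 2)"
    by (simp add: sin_squared_eq field_simps power2_eq_square)
  then show ?thesis unfolding nehari_p_real by (simp only:) (simp add: algebra_simps)
qed

text \<open>
  The derivative contains \<open>(1 - x\<^sup>2) sin (pi x / 2)\<close> with a nonnegative factor. Replacing it by its
  Becker--Stark bound leaves \<open>x\<close> times \<open>l * R - 4\<close>, where \<open>R\<close> depends on \<open>x\<close> only through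
  \<open>c = cos (pi x / 2)\<close> and is largest at \<open>c = 1\<close>. The bound is an asymptotic equality as \<open>x\<close>
  tends to \<open>0\<close>, so nothing is lost there and \<open>l * R \<le> 4\<close> at \<open>c = 1\<close> is exactly the
  quadratic condition on \<open>l\<close>.
\<close>
lemma nehari_weight_antimono:
  fixes x y :: real
  assumes l: "0 \<le> l" "l \<le> lambda0" and xy: "0 \<le> x" "x \<le> y" "y < 1"
  shows "(1 - y\<^sup>2)\<^sup>2 * nehari_p l y \<le> (1 - x\<^sup>2)\<^sup>2 * nehari_p l x"
proof -
  define c s where "c = (\<lambda>t. cos (pi * t / 2))" and "s = (\<lambda>t. sin (pi * t / 2))"
  define M where "M = (\<lambda>t. (1 - t\<^sup>2)\<^sup>2 * (1 + l * (2 / c t - 3 * c t) - l\<^sup>2 * (s t)\<^sup>2))"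
  define M' where "M' = (\<lambda>t. (1 - t\<^sup>2) *
      ((1 - t\<^sup>2) * s t * (pi / 2 * l * (2 / (c t)\<^sup>2 + 3 - 2 * l * c t))
        - 4 * t * (1 + l * (2 / c t - 3 * c t) - l\<^sup>2 * (s t)\<^sup>2)))"
  have weight: "(1 - t\<^sup>2)\<^sup>2 * nehari_p l t = pi\<^sup>2 / 4 * M t" if "\<bar>t\<bar> < 1" for t
    using nehari_p_alt[OF that] by (simp add: M_def c_def s_def)
  have "M y \<le> M x"
  proof (rule DERIV_nonpos_imp_nonincreasing[OF xy(2)])
    fix t assume "x \<le> t" "t \<le> y"
    with xy have t: "0 \<le> t" "t < 1" by auto
    have c: "0 < c t" "c t \<le> 1" using cos_half_pi_pos[of t] t by (auto simp: c_def)
    have dc: "(c has_real_derivative - pi / 2 * s t) (at t)"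
      and ds: "(s has_real_derivative pi / 2 * c t) (at t)"
      unfolding c_def s_def by (auto intro!: derivative_eq_intros)
    have "(M has_real_derivative M' t) (at t)"
      unfolding M_def M'_def using c
      by (auto intro!: derivative_eq_intros dc ds simp: field_simps) (simp add: power2_eq_square power4_eq_xxxx algebra_simps)
    moreover have "M' t \<le> 0"
    proof -
      have "(1 - t\<^sup>2) * s t \<le> pi / 2 * t * c t"
        using becker_stark_upper[of "pi * t / 2"] t
        by (simp add: c_def s_def power2_eq_square field_simps)
      moreover have "0 \<le> pi / 2 * l * (2 / (c t)\<^sup>2 + 3 - 2 * l * c t)"
      proof -
        have "l * c t \<le> 1/2 * 1"
          using c l lambda_le_half[OF l] by (intro mult_mono) auto
        then have "2 * l * c t \<le> 0 + 3" by simp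
        also have "\<dots> \<le> 2 / (c t)\<^sup>2 + 3" by simp
        finally show ?thesis using l by (intro mult_nonneg_nonneg) auto
      qed
      ultimately have "(1 - t\<^sup>2) * s t * (pi / 2 * l * (2 / (c t)\<^sup>2 + 3 - 2 * l * c t))
          \<le> pi / 2 * t * c t * (pi / 2 * l * (2 / (c t)\<^sup>2 + 3 - 2 * l * c t))"
        by (rule mult_right_mono)
      also have "\<dots> - 4 * t * (1 + l * (2 / c t - 3 * c t) - l\<^sup>2 * (s t)\<^sup>2)
          = t * (l * ((pi\<^sup>2/2 - 8) / c t + (3/4 * pi\<^sup>2 + 12) * c t + 4 * l
                   - l * (4 + pi\<^sup>2/2) * (c t)\<^sup>2) - 4)"
      proof -
        have "(s t)\<^sup>2 = 1 - (c t)\<^sup>2" by (simp add: s_def c_def sin_squared_eq)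
        then show ?thesis using c by (simp only:) (simp add: power2_eq_square field_simps)
      qed
      also have "\<dots> \<le> 0"
      proof -
        define q where "q = (8 - pi\<^sup>2/2) / c t"
        have "0 \<le> q" using c pi_squared_bounds by (simp add: q_def)
        moreover have "l * ((4 + pi\<^sup>2/2) * (1 + c t)) \<le> 1/2 * ((4 + pi\<^sup>2/2) * 2)"
          using lambda_le_half[OF l] l c by (intro mult_mono) auto
        then have "l * ((4 + pi\<^sup>2/2) * (1 + c t)) \<le> 3/4 * pi\<^sup>2 + 12" 
          using pi_squared_bounds by auto
        ultimately have "0 \<le> q + (3/4 * pi\<^sup>2 + 12) - l * ((4 + pi\<^sup>2/2) * (1 + c t))" by simp
        then have "0 \<le> (8 - pi\<^sup>2/2) / c t + (3/4 * pi\<^sup>2 + 12) - l * ((4 + pi\<^sup>2/2) * (1 + c t))"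
          by (simp only: q_def)
        \<comment> \<open>The product below is the value of \<open>R\<close> at \<open>1\<close> minus its value at \<open>c\<close>.\<close>
        with c(2) have "0 \<le> (1 - c t) * ((8 - pi\<^sup>2/2) / c t + (3/4 * pi\<^sup>2 + 12)
                           - l * ((4 + pi\<^sup>2/2) * (1 + c t)))"
          by (intro mult_nonneg_nonneg) auto
        also have "\<dots> = 5/4 * pi\<^sup>2 + 4 - l * (pi\<^sup>2 / 2) - ((pi\<^sup>2/2 - 8) / c t + (3/4 * pi\<^sup>2 + 12) * c t
            + 4 * l - l * (4 + pi\<^sup>2/2) * (c t)\<^sup>2)"
          using c by (simp add: power2_eq_square field_simps)
        finally have "l * ((pi\<^sup>2/2 - 8) / c t + (3/4 * pi\<^sup>2 + 12) * c t + 4 * l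
                   - l * (4 + pi\<^sup>2/2) * (c t)\<^sup>2) \<le> l * (5/4 * pi\<^sup>2 + 4 - l * (pi\<^sup>2 / 2))"
          using l by (intro mult_left_mono) auto
        with lambda_quadratic[OF l] t show ?thesis
          by (intro mult_nonneg_nonpos) auto
      qed
      finally have "(1 - t\<^sup>2) * s t * (pi / 2 * l * (2 / (c t)\<^sup>2 + 3 - 2 * l * c t))
        - 4 * t * (1 + l * (2 / c t - 3 * c t) - l\<^sup>2 * (s t)\<^sup>2) \<le> 0" by simp
      moreover have "0 \<le> 1 - t\<^sup>2" using t by (simp add: abs_square_le_1)
      ultimately show ?thesis unfolding M'_def by (intro mult_nonneg_nonpos)
    qed
    ultimately show "\<exists>d. (M has_real_derivative d) (at t) \<and> d \<le> 0" by blast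
  qed
  then have "pi\<^sup>2 / 4 * M y \<le> pi\<^sup>2 / 4 * M x" by (intro mult_left_mono) auto
  moreover have "\<bar>x\<bar> < 1" "\<bar>y\<bar> < 1" using xy by auto
  ultimately show ?thesis by (simp only: weight)
qed

section \<open>Nonnegative Taylor coefficients\<close>

lemma nonneg_taylor_imp_majorant:
  fixes f :: "complex \<Rightarrow> complex"
  assumes hol: "f holomorphic_on ball 0 r" and exp: "f has_fps_expansion F"
    and nonneg: "\<And>n. fps_nth F n \<in> \<real>\<^sub>\<ge>\<^sub>0" and w: "cmod w < r"
  shows "cmod (f w) \<le> Re (f (of_real (cmod w)))"
proof -
  define a where "a = (\<lambda>n. Re (fps_nth F n))"
  have a: "fps_nth F n = of_real (a n)" "0 \<le> a n" for n
    using nonneg[of n] by (auto simp: a_def elim!: nonneg_Reals_cases)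
  have S: "(\<lambda>n. of_real (a n) * v ^ n) sums f v" if "cmod v < r" for v
    using holomorphic_power_series[OF hol, of v] that fps_nth_fps_expansion[OF exp] a(1)
    by simp
  have R: "(\<lambda>n. complex_of_real (a n * cmod w ^ n)) sums f (of_real (cmod w))"
    using S[of "of_real (cmod w)"] w by simp
  then have M: "(\<lambda>n. a n * cmod w ^ n) sums Re (f (of_real (cmod w)))"
    using sums_Re by force
  have "cmod (\<Sum>n. of_real (a n) * w ^ n) \<le> (\<Sum>n. a n * cmod w ^ n)"
    by (rule norm_suminf_le) (use M a in \<open>auto simp: norm_mult norm_power sums_iff\<close>)
  then show "cmod (f w) \<le> Re (f (of_real (cmod w)))"
    using S[OF w] M by (simp add: sums_iff)
qed

text \<open>
  The coefficients of \<open>sec\<close> and \<open>tan\<close> are controlled through the differential equations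
  \<open>sec' = sec tan\<close> and \<open>tan' = 1 + tan\<^sup>2\<close>, whose right-hand sides have nonnegative coefficients as soon
  as \<open>sec\<close> and \<open>tan\<close> have. Each coefficient of the left-hand side involves only earlier ones on the
  right, so nonnegativity propagates by induction.
\<close>
definition fps_sec :: "complex fps" where
  "fps_sec = inverse (fps_cos 1)"

lemma fps_cos_times_sec: "fps_cos 1 * fps_sec = 1"
  unfolding fps_sec_def using inverse_mult_eq_1[of "fps_cos (1::complex)"] by (simp add: mult.commute)

lemma fps_tan_eq: "fps_tan 1 = fps_sin 1 * fps_sec"
  unfolding fps_tan_def fps_sec_def by (simp add: fps_divide_unit)

lemma fps_deriv_sec: "fps_deriv fps_sec = fps_sec * fps_tan 1"
proof -
  have "fps_deriv (fps_cos 1 * fps_sec) = (0 :: complex fps)" by (simp add: fps_cos_times_sec)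
  then have "fps_cos 1 * fps_deriv fps_sec = fps_sin 1 * fps_sec"
    by (simp add: fps_cos_deriv flip: fps_const_neg)
  moreover have "fps_deriv fps_sec = fps_cos 1 * fps_sec * fps_deriv fps_sec"
    by (simp add: fps_cos_times_sec)
  ultimately have "fps_deriv fps_sec = fps_sec * (fps_sin 1 * fps_sec)"
    by (metis mult.assoc mult.commute)
  then show ?thesis by (simp add: fps_tan_eq)
qed

lemma fps_deriv_tan: "fps_deriv (fps_tan 1) = 1 + (fps_tan 1 :: complex fps)\<^sup>2"
proof -
  have "fps_deriv (fps_tan 1) = fps_cos 1 * fps_sec + fps_sin 1 * (fps_sec * fps_tan 1)"
    by (simp add: fps_tan_eq fps_sin_deriv fps_deriv_sec)
  then show ?thesis by (simp add: fps_cos_times_sec fps_tan_eq power2_eq_square mult.assoc)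
qed

lemma nonneg_Reals_sum_I:
  "(\<And>i. i \<in> A \<Longrightarrow> f i \<in> \<real>\<^sub>\<ge>\<^sub>0) \<Longrightarrow> sum f A \<in> \<real>\<^sub>\<ge>\<^sub>0" for f :: "_ \<Rightarrow> complex"
  by (induction A rule: infinite_finite_induct) auto

lemma fps_mult_nonneg:
  fixes F G :: "complex fps"
  assumes "\<And>i. fps_nth F i \<in> \<real>\<^sub>\<ge>\<^sub>0" "\<And>i. fps_nth G i \<in> \<real>\<^sub>\<ge>\<^sub>0"
  shows "fps_nth (F * G) n \<in> \<real>\<^sub>\<ge>\<^sub>0"
  using assms unfolding fps_mult_nth by (intro nonneg_Reals_sum_I nonneg_Reals_mult_I) auto

lemma fps_tan_nonneg: "fps_nth (fps_tan 1) n \<in> (\<real>\<^sub>\<ge>\<^sub>0 :: complex set)"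
proof (induction n rule: less_induct)
  case (less n)
  show ?case
  proof (cases n)
    case 0
    then show ?thesis by (simp add: fps_tan_eq)
  next
    case (Suc k)
    have "of_nat (k + 1) * fps_nth (fps_tan 1) (k + 1) = fps_nth (1 + (fps_tan 1 :: complex fps)\<^sup>2) k"
      using arg_cong[OF fps_deriv_tan, of "\<lambda>F. fps_nth F k"] by simp
    also have "\<dots> = (if k = 0 then 1 else 0)
        + (\<Sum>i=0..k. fps_nth (fps_tan 1) i * fps_nth (fps_tan 1) (k - i))"
      by (simp add: power2_eq_square fps_mult_nth)
    finally have "fps_nth (fps_tan 1) n = ((if k = 0 then 1 else 0)
        + (\<Sum>i=0..k. fps_nth (fps_tan 1) i * fps_nth (fps_tan 1) (k - i))) / (of_nat (k + 1) :: complex)"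
      by (subst eq_divide_eq) (auto simp: Suc mult.commute simp del: of_nat_Suc)
    also have "\<dots> \<in> \<real>\<^sub>\<ge>\<^sub>0"
      using less Suc
      by (intro nonneg_Reals_divide_I nonneg_Reals_add_I nonneg_Reals_sum_I nonneg_Reals_mult_I nonneg_Reals_of_nat_I) auto
    finally show ?thesis .
  qed
qed

lemma fps_sec_nonneg: "fps_nth fps_sec n \<in> \<real>\<^sub>\<ge>\<^sub>0"
proof (induction n rule: less_induct)
  case (less n)
  show ?case
  proof (cases n)
    case 0
    then show ?thesis by (simp add: fps_sec_def)
  next
    case (Suc k)
    have "of_nat (k + 1) * fps_nth fps_sec (k + 1)
        = (\<Sum>i=0..k. fps_nth fps_sec i * fps_nth (fps_tan 1) (k - i))"
      using arg_cong[OF fps_deriv_sec, of "\<lambda>F. fps_nth F k"] by (simp add: fps_mult_nth)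
    then have "fps_nth fps_sec n
        = (\<Sum>i=0..k. fps_nth fps_sec i * fps_nth (fps_tan 1) (k - i)) / of_nat (k + 1)"
      by (subst eq_divide_eq) (auto simp: Suc mult.commute simp del: of_nat_Suc)
    also have "\<dots> \<in> \<real>\<^sub>\<ge>\<^sub>0"
      using less Suc fps_tan_nonneg
      by (intro nonneg_Reals_divide_I nonneg_Reals_sum_I nonneg_Reals_mult_I nonneg_Reals_of_nat_I) auto
    finally show ?thesis .
  qed
qed

text \<open>
  These are the secant numbers \<open>1, 0, 1, 0, 5, 0, 61, ...\<close>, that is, the Euler numbers without their
  signs.
\<close>
definition euler_number :: "nat \<Rightarrow> real" where
  "euler_number n = fact n * Re (fps_nth fps_sec n)"

lemma fps_nth_sec: "fps_nth fps_sec n = of_real (euler_number n / fact n)"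
  using fps_sec_nonneg[of n] by (auto simp: euler_number_def elim!: nonneg_Reals_cases)

lemma euler_number_nonneg: "0 \<le> euler_number n"
  using fps_sec_nonneg[of n] by (auto simp: euler_number_def elim!: nonneg_Reals_cases)

lemma euler_number_0: "euler_number 0 = 1"
  by (simp add: euler_number_def fps_sec_def)

lemma fps_deriv2_sec: "fps_deriv (fps_deriv fps_sec) = fps_sec + 2 * fps_sec * (fps_tan 1)\<^sup>2"
  by (simp add: fps_deriv_sec fps_deriv_tan algebra_simps power2_eq_square)

lemma euler_number_2: "euler_number 2 = 1"
proof -
  have "2 * fps_nth fps_sec 2 = fps_nth (fps_deriv (fps_deriv fps_sec)) 0"
    by (simp add: numeral_2_eq_2)
  also have "\<dots> = 1"
    by (simp only: fps_deriv2_sec) (simp add: power2_eq_square fps_sec_def fps_tan_eq)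
  finally have "Re (2 * fps_nth fps_sec 2) = 1" by simp
  then show ?thesis by (simp add: euler_number_def)
qed

text \<open>
  In \<open>sec'' = sec + 2 sec tan\<^sup>2\<close> the series of \<open>tan\<close> dominates its first term \<open>x\<close>, so
  \<open>sec'' - sec - 2 x\<^sup>2 sec\<close> has nonnegative coefficients.
\<close>
lemma euler_number_step:
  "euler_number (n + 2) + 2 * real ((n + 2) * (n + 1)) * euler_number n \<le> euler_number (n + 4)"
proof -
  define T where "T = (fps_tan 1 - fps_X :: complex fps)"
  have T0: "fps_nth T i \<in> \<real>\<^sub>\<ge>\<^sub>0" for i
  proof (cases "i = 1")
    case True
    have "fps_nth (fps_tan 1 :: complex fps) 1 = 1"
      using arg_cong[OF fps_deriv_tan, of "\<lambda>F. fps_nth F 0"]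
      by (simp add: power2_eq_square fps_tan_eq)
    with True show ?thesis by (simp add: T_def)
  next
    case False
    then show ?thesis using fps_tan_nonneg[of i] by (simp add: T_def)
  qed
  have "fps_deriv (fps_deriv fps_sec) - fps_sec - fps_const 2 * (fps_X ^ 2 * fps_sec)
        = 2 * (fps_sec * (2 * (fps_X * T) + T * T))"
    by (simp add: fps_deriv2_sec T_def power2_eq_square algebra_simps flip: numeral_fps_const)
  then have "fps_nth (fps_deriv (fps_deriv fps_sec) - fps_sec - fps_const 2 * (fps_X ^ 2 * fps_sec)) (n + 2)
        = 2 * fps_nth (fps_sec * (2 * (fps_X * T) + T * T)) (n + 2)"
    by (simp only:) (simp add: numeral_fps_const)
  also have "\<dots> \<in> \<real>\<^sub>\<ge>\<^sub>0"
  proof -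
    have X: "fps_nth (fps_X :: complex fps) i \<in> \<real>\<^sub>\<ge>\<^sub>0" for i by simp
    have "fps_nth (fps_const 2 * (fps_X * T) + T * T) i \<in> \<real>\<^sub>\<ge>\<^sub>0" for i
      using fps_mult_nonneg[OF X T0, of i] fps_mult_nonneg[OF T0 T0, of i] by simp
    from fps_mult_nonneg[OF fps_sec_nonneg this, of "n + 2"] show ?thesis
      by (intro nonneg_Reals_mult_I) (simp_all add: numeral_fps_const)
  qed
  also have "fps_nth (fps_deriv (fps_deriv fps_sec) - fps_sec - fps_const 2 * (fps_X ^ 2 * fps_sec)) (n + 2)
      = of_real (real (n + 3) * (real (n + 4) * (euler_number (n + 4) / fact (n + 4)))
          - euler_number (n + 2) / fact (n + 2) - 2 * (euler_number n / fact n))"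
  proof -
    have "fps_nth (fps_deriv (fps_deriv fps_sec)) (n + 2) = of_nat (n + 3) * (of_nat (n + 4) * fps_nth fps_sec (n + 4))"
      by (simp add: numeral_eq_Suc)
    moreover have "fps_nth (fps_const 2 * (fps_X ^ 2 * fps_sec)) (n + 2) = 2 * fps_nth fps_sec n"
      by (simp add: fps_X_power_mult_nth)
    ultimately show ?thesis by (simp add: fps_nth_sec)
  qed
  finally have "0 \<le> real (n + 3) * (real (n + 4) * (euler_number (n + 4) / fact (n + 4)))
          - euler_number (n + 2) / fact (n + 2) - 2 * (euler_number n / fact n)"
    by (simp only: nonneg_Reals_of_real_iff)
  then have "0 \<le> fact (n + 2) * (real (n + 3) * (real (n + 4) * (euler_number (n + 4) / fact (n + 4)))
          - euler_number (n + 2) / fact (n + 2) - 2 * (euler_number n / fact n))"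
    by simp
  moreover have "(fact (n + 4) :: real) = fact (n + 2) * (real (n + 3) * real (n + 4))"
    and f2: "(fact (n + 2) :: real) = real ((n + 2) * (n + 1)) * fact n"
    by (simp_all add: numeral_eq_Suc algebra_simps)
  then have "fact (n + 2) * (real (n + 3) * (real (n + 4) * (euler_number (n + 4) / fact (n + 4)))) = euler_number (n + 4)"
    by simp
  moreover have "fact (n + 2) * (2 * (euler_number n / fact n)) = 2 * real ((n + 2) * (n + 1)) * euler_number n"
    unfolding f2 by simp
  moreover have "fact (n + 2) * (euler_number (n + 2) / fact (n + 2)) = euler_number (n + 2)"
    by simp
  ultimately show ?thesis unfolding right_diff_distrib by linarith
qed

text \<open>
  The recursion multiplies by at least \<open>24\<close> over two steps from index \<open>2\<close> on, which exceeds the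
  growth \<open>4\<^sup>2\<close> of the bound. The constant \<open>1/5\<close> is small enough for the initial values \<open>1, 1, 5\<close> and
  large enough to dominate the coefficients of \<open>sin\<^sup>2\<close>, which are of size \<open>4\<^sup>n / 2\<close> on the same scale
  and carry one more factor \<open>l \<le> 1/2\<close>.
\<close>
lemma euler_number_lower_bound: "4 ^ n / 5 \<le> euler_number (2 * n)"
proof (induction n rule: less_induct)
  case (less n)
  consider "n = 0" | "n = 1" | "n = 2" | k where "n = k + 3"
    by (metis One_nat_def add.commute add_2_eq_Suc' less_2_cases_iff le_add_diff_inverse not_less_eq numeral_2_eq_2 numeral_3_eq_3 not_less)
  then show ?case
  proof cases
    case 3
    have "5 \<le> euler_number 4"
      using euler_number_step[of 0, unfolded add_0 euler_number_0 euler_number_2] by simp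
    with 3 show ?thesis by simp
  next
    case 4
    define m where "m = 2 * k + 2"
    have idx: "2 * (k + 1) = m" "2 * (k + 2) = m + 2" "2 * n = m + 4" using 4 by (auto simp: m_def)
    have "4 ^ (k + 1) / 5 \<le> euler_number m" "4 ^ (k + 2) / 5 \<le> euler_number (m + 2)"
      using less[of "k + 1"] less[of "k + 2"] 4 unfolding idx by auto
    moreover have twelve: "12 * euler_number m \<le> real ((m + 2) * (m + 1)) * euler_number m"
      using euler_number_nonneg by (intro mult_right_mono) (auto simp: m_def)
    moreover from twelve have "euler_number (m + 2) + 24 * euler_number m \<le> euler_number (m + 4)"
      using euler_number_step[of m] by linarith
    moreover have "(4::real) ^ (k + 1) = 4 * 4 ^ k" "(4::real) ^ (k + 2) = 16 * 4 ^ k"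
      "(4::real) ^ n = 64 * 4 ^ k" "(0::real) < 4 ^ k"
      using 4 by (simp_all add: power_add)
    ultimately have "4 ^ n / 5 \<le> euler_number (m + 4)" by linarith
    then show ?thesis by (simp only: idx)
  qed (simp_all add: euler_number_0 euler_number_2)
qed

lemma cos_nonzero_disc: "cmod w < pi / 2 \<Longrightarrow> cos w \<noteq> 0"
proof
  assume w: "cmod w < pi / 2" "cos w = 0"
  then obtain n :: int where "w = of_real (of_int n * pi + pi / 2)" by (auto simp: cos_eq_0)
  then have "cmod w = \<bar>of_int n * pi + pi / 2\<bar>" by (simp only: norm_of_real)
  also have "\<dots> = \<bar>of_int (2 * n + 1)\<bar> * (pi / 2)"
    by (subst abs_of_pos[of "pi / 2", symmetric], simp, subst abs_mult[symmetric]) (simp add: algebra_simps)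
  finally have "\<bar>of_int (2 * n + 1)\<bar> * (pi / 2) < 1 * (pi / 2)" using w by simp
  then have "\<bar>of_int (2 * n + 1) :: real\<bar> < 1" by (simp only: mult_less_cancel_right_pos[OF pi_half_gt_zero])
  then have "\<bar>2 * n + 1\<bar> < 1" by linarith
  then show False by presburger
qed

lemma fps_cos_nth_even: "fps_nth (fps_cos c) (2 * k) = (-1) ^ k * c ^ (2 * k) / fact (2 * k)"
  by (simp add: fps_cos_def)

text \<open>
  Up to the scaling \<open>w = pi z / 2\<close>, the function is
  \<open>1 + l (2 sec - 3 cos) - l\<^sup>2 sin\<^sup>2\<close> with \<open>sin\<^sup>2 w = (1 - cos (2 w)) / 2\<close>. At odd indices only \<open>sec\<close>
  contributes. At an index \<open>2 k > 0\<close> either the term from \<open>cos\<close> or the one from \<open>sin\<^sup>2\<close> is negative,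
  according to the parity of \<open>k\<close>, and the Euler number outweighs it.
\<close>
lemma self_majorant_nehari_p:
  assumes l: "0 \<le> l" "l \<le> lambda0"
  shows "self_majorant (nehari_p l)"
proof -
  define L where "L = complex_of_real l"
  define g where "g = (\<lambda>w. 1 + L * (2 * inverse (cos w) - 3 * cos w) - L\<^sup>2 * (sin w)\<^sup>2)"
  define G where "G = 1 + fps_const L * (2 * fps_sec - 3 * fps_cos 1) - fps_const (L\<^sup>2) * (fps_sin 1)\<^sup>2"
  have arg: "complex_of_real pi * z / 2 = complex_of_real (pi / 2) * z" for z by simp
  have pg: "nehari_p l z = of_real (pi\<^sup>2 / 4) * g (of_real (pi / 2) * z)" if "cmod z < 1" for z
  proof -
    have c: "cos (of_real (pi / 2) * z) \<noteq> 0"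
      by (rule cos_nonzero_disc) (use that in \<open>simp add: norm_mult\<close>)
    have "(sin (of_real (pi / 2) * z))\<^sup>2 / cos (of_real (pi / 2) * z)
        = inverse (cos (of_real (pi / 2) * z)) - cos (of_real (pi / 2) * z)"
      using c by (simp add: sin_squared_eq field_simps power2_eq_square)
    then show ?thesis unfolding nehari_p_def g_def L_def arg by (simp only:) (simp add: algebra_simps)
  qed
  have hol: "g holomorphic_on ball 0 (pi / 2)"
    unfolding g_def by (intro holomorphic_intros) (auto simp: cos_nonzero_disc)
  have exp: "g has_fps_expansion G"
    unfolding g_def G_def fps_sec_def numeral_fps_const fps_const_1_eq_1[symmetric] power2_eq_square
    by (intro fps_expansion_intros has_fps_expansion_sin' has_fps_expansion_cos') auto
  have nonneg: "fps_nth G n \<in> \<real>\<^sub>\<ge>\<^sub>0" for n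
  proof -
    have half: "l \<le> 1/2" using lambda_le_half[OF l] .
    have "fps_cos (1 + 1) = fps_cos 1 * fps_cos 1 - fps_sin 1 * (fps_sin 1 :: complex fps)"
      by (rule fps_cos_add)
    then have "fps_cos 2 = ((fps_cos 1)\<^sup>2 + (fps_sin 1)\<^sup>2) - 2 * (fps_sin 1 :: complex fps)\<^sup>2"
      by (simp add: power2_eq_square)
    then have "fps_cos 2 = 1 - 2 * (fps_sin 1 :: complex fps)\<^sup>2"
      by (simp only: fps_sin_cos_sum_of_squares)
    then have "(fps_sin 1 :: complex fps)\<^sup>2 = fps_const (1/2) * (1 - fps_cos 2)"
      by (simp add: numeral_fps_const fps_const_mult[symmetric] mult.assoc[symmetric] del: fps_const_mult) 
    then have sin2: "fps_nth ((fps_sin 1 :: complex fps)\<^sup>2) n = ((if n = 0 then 1 else 0) - fps_nth (fps_cos 2) n) / 2"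
      by (simp only:) simp
    have G_nth: "fps_nth G n = (if n = 0 then 1 - L\<^sup>2 / 2 else 0)
        + L * (2 * fps_nth fps_sec n - 3 * fps_nth (fps_cos 1) n) + L\<^sup>2 / 2 * fps_nth (fps_cos 2) n"
      by (simp add: G_def numeral_fps_const sin2 algebra_simps)
    show ?thesis
    proof (cases "even n")
      case False
      then have "fps_nth G n = of_real (2 * l * (euler_number n / fact n))"
        unfolding G_nth fps_nth_sec by (auto simp: fps_cos_def L_def)
      then show ?thesis using l euler_number_nonneg[of n]
        by (simp only: nonneg_Reals_of_real_iff) simp
    next
      case True
      then obtain k where k: "n = 2 * k" by (auto elim: evenE)
      show ?thesis
      proof (cases "k = 0")
        case True
        with k have "fps_nth G n = of_real (1 - l)"
          unfolding G_nth fps_nth_sec by (simp add: L_def euler_number_0)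
        then show ?thesis using half by (simp only: nonneg_Reals_of_real_iff)
      next
        case False
        have four: "(2::complex) ^ k * 2 ^ k = 4 ^ k" by (simp flip: power_mult_distrib)
        have "fps_nth G n = of_real (l * (2 * euler_number n - 3 * (-1) ^ k + l / 2 * ((-1) ^ k * 4 ^ k)) / fact n)"
          unfolding G_nth fps_nth_sec unfolding k fps_cos_nth_even using False four
          by (simp add: L_def field_simps power2_eq_square power_mult)
        moreover have "0 \<le> 2 * euler_number n - 3 * (-1) ^ k + l / 2 * ((-1) ^ k * 4 ^ k)"
        proof (cases "even k")
          case True
          with False have "2 \<le> k" by presburger
          then have "(4::real) ^ 2 \<le> 4 ^ k" by (intro power_increasing) auto
          moreover have "0 \<le> l / 2 * 4 ^ k" using l by simp
          ultimately show ?thesis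
            using euler_number_lower_bound[of k] True by (simp add: k)
        next
          case False
          have "l / 2 * 4 ^ k \<le> (1/2) / 2 * 4 ^ k"
            using half by (intro mult_right_mono divide_right_mono) auto
          moreover have "(-1::real) ^ k = - 1" using False by simp
          moreover have "(0::real) < 4 ^ k" by simp
          ultimately show ?thesis
            using euler_number_lower_bound[of k] unfolding k by (simp only:)
        qed
        ultimately show ?thesis using l
          by (simp only: nonneg_Reals_of_real_iff) simp
      qed
    qed
  qed
  have "nehari_p l holomorphic_on ball 0 1"
  proof -
    have "(\<lambda>z. of_real (pi\<^sup>2 / 4) * g (of_real (pi / 2) * z)) holomorphic_on ball 0 1"
      by (intro holomorphic_intros holomorphic_on_compose_gen[OF _ hol, unfolded o_def])
        (auto simp: norm_mult)
    then show ?thesis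
      by (rule holomorphic_transform) (simp add: pg)
  qed
  then have "nehari_p l analytic_on ball 0 1" by (simp add: analytic_on_open)
  moreover have "nehari_p l (complex_of_real (cmod z)) \<in> \<real> \<and> cmod (nehari_p l z) \<le> Re (nehari_p l (of_real (cmod z)))"
    if "cmod z < 1" for z
  proof -
    have "cmod (of_real (pi / 2) * z) < pi / 2" using that by (simp add: norm_mult)
    note maj = nonneg_taylor_imp_majorant[OF hol exp nonneg this]
    have "cmod (nehari_p l z) = pi\<^sup>2 / 4 * cmod (g (of_real (pi / 2) * z))"
      unfolding pg[OF that] by (simp add: norm_mult norm_power)
    also have "\<dots> \<le> pi\<^sup>2 / 4 * Re (g (of_real (cmod (of_real (pi / 2) * z))))"
      using maj by (intro mult_left_mono) auto
    also have "\<dots> = Re (nehari_p l (of_real (cmod z)))"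
    proof -
      have "cmod (of_real (cmod z)) < 1" using that by simp
      from pg[OF this] show ?thesis by (simp only:) (simp add: norm_mult)
    qed
    finally show ?thesis by (simp add: nehari_p_of_real)
  qed
  ultimately show ?thesis by (simp add: self_majorant_def)
qed

section \<open>Comparison of linear second-order equations\<close>

text \<open>
  Here \<open>k = y' / y\<close> for a positive solution of \<open>y'' + p y = 0\<close>. Integrated over the interval, the
  argument is the Wirtinger-type inequality that \<open>\<bar>u'\<bar>\<^sup>2 - p \<bar>u\<bar>\<^sup>2\<close> and \<open>\<bar>u' - k u\<bar>\<^sup>2\<close> have the same
  integral if \<open>u\<close> vanishes at both ends. In differential form:
  \<open>F = Re (u' * cnj u) - k \<bar>u\<bar>\<^sup>2\<close> vanishes at both ends and
  \<open>F' = \<bar>u' - k u\<bar>\<^sup>2 + (p - Re Q) \<bar>u\<bar>\<^sup>2 \<ge> 0\<close>. So \<open>F\<close> is constant, whereas \<open>F' a = \<bar>u' a\<bar>\<^sup>2\<close>.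
\<close>
lemma vanishing_twice_below_riccati:
  fixes u u' Q :: "real \<Rightarrow> complex" and p k :: "real \<Rightarrow> real"
  assumes ab: "a < b"
    and du: "\<And>x. a \<le> x \<Longrightarrow> x \<le> b \<Longrightarrow> (u has_vector_derivative u' x) (at x)"
    and du': "\<And>x. a \<le> x \<Longrightarrow> x \<le> b \<Longrightarrow> (u' has_vector_derivative - (Q x * u x)) (at x)"
    and dk: "\<And>x. a \<le> x \<Longrightarrow> x \<le> b \<Longrightarrow> (k has_real_derivative - p x - (k x)\<^sup>2) (at x)"
    and Q: "\<And>x. a \<le> x \<Longrightarrow> x \<le> b \<Longrightarrow> Re (Q x) \<le> p x"
    and zero: "u a = 0" "u b = 0"
  shows "u' a = 0"
proof (rule ccontr)
  assume nz: "u' a \<noteq> 0"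
  define U V U' V' where "U = (\<lambda>x. Re (u x))" and "V = (\<lambda>x. Im (u x))"
    and "U' = (\<lambda>x. Re (u' x))" and "V' = (\<lambda>x. Im (u' x))"
  define F where "F = (\<lambda>x. U x * U' x + V x * V' x - k x * ((U x)\<^sup>2 + (V x)\<^sup>2))"
  define F' where "F' = (\<lambda>x. (U' x - k x * U x)\<^sup>2 + (V' x - k x * V x)\<^sup>2
                        + (p x - Re (Q x)) * ((U x)\<^sup>2 + (V x)\<^sup>2))"
  have dF: "(F has_real_derivative F' x) (at x)" if "a \<le> x" "x \<le> b" for x
  proof -
    have "(U has_real_derivative U' x) (at x)" "(V has_real_derivative V' x) (at x)"
      using bounded_linear.has_vector_derivative[OF bounded_linear_Re du[OF that]]
        bounded_linear.has_vector_derivative[OF bounded_linear_Im du[OF that]]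
      by (simp_all add: U_def V_def U'_def V'_def has_real_derivative_iff_has_vector_derivative)
    moreover have "(U' has_real_derivative - (Re (Q x) * U x - Im (Q x) * V x)) (at x)"
      "(V' has_real_derivative - (Re (Q x) * V x + Im (Q x) * U x)) (at x)"
      using bounded_linear.has_vector_derivative[OF bounded_linear_Re du'[OF that]]
        bounded_linear.has_vector_derivative[OF bounded_linear_Im du'[OF that]]
      by (simp_all add: U_def V_def U'_def V'_def has_real_derivative_iff_has_vector_derivative)
    ultimately show ?thesis
      unfolding F_def F'_def
      by (auto intro!: derivative_eq_intros dk[OF that] simp: power2_eq_square algebra_simps)
  qed
  have "0 < F' a"
  proof -
    have "(U' a)\<^sup>2 + (V' a)\<^sup>2 = (cmod (u' a))\<^sup>2" by (simp add: U'_def V'_def cmod_power2)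
    with nz show ?thesis using zero by (simp add: F'_def U_def V_def)
  qed
  from DERIV_pos_inc_right[OF dF this] ab obtain d where
    d: "0 < d" "\<And>h. 0 < h \<Longrightarrow> h < d \<Longrightarrow> F a < F (a + h)" by auto
  define h where "h = min (d / 2) (b - a)"
  have h: "0 < h" "h < d" "a + h \<le> b" using d ab by (auto simp: h_def)
  have "F (a + h) \<le> F b"
  proof (rule DERIV_nonneg_imp_nondecreasing[OF h(3)])
    fix x assume "a + h \<le> x" "x \<le> b"
    then have x: "a \<le> x" "x \<le> b" using h by auto
    have "0 \<le> F' x" using Q[OF x] by (simp add: F'_def)
    then show "\<exists>D. (F has_real_derivative D) (at x) \<and> 0 \<le> D" using dF[OF x] by blast
  qed
  moreover have "F a = 0" "F b = 0" using zero by (simp_all add: F_def U_def V_def)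
  ultimately show False using d(2)[OF h(1,2)] by simp
qed

text \<open>
  As long as \<open>u > 0\<close>, the Wronskian \<open>W = u' y - u y'\<close> decreases from \<open>0\<close>, strictly at first because
  \<open>p a < q a\<close>. If \<open>u\<close> stayed positive up to \<open>1\<close>, then \<open>(u / y)' = W / y\<^sup>2\<close> would be at most a negative
  multiple of \<open>1 / (1 - x)\<^sup>2\<close> near \<open>1\<close>, and \<open>u / y\<close> would tend to minus infinity. At the first zero,
  \<open>W < 0\<close> gives the sign of \<open>u'\<close>.
\<close>
lemma solution_vanishes_before_endpoint:
  fixes u u' y y' p q :: "real \<Rightarrow> real"
  assumes a: "a < 1"
    and du: "\<And>x. a \<le> x \<Longrightarrow> x < 1 \<Longrightarrow> (u has_real_derivative u' x) (at x)"
    and du': "\<And>x. a \<le> x \<Longrightarrow> x < 1 \<Longrightarrow> (u' has_real_derivative - (q x * u x)) (at x)"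
    and dy: "\<And>x. a \<le> x \<Longrightarrow> x < 1 \<Longrightarrow> (y has_real_derivative y' x) (at x)"
    and dy': "\<And>x. a \<le> x \<Longrightarrow> x < 1 \<Longrightarrow> (y' has_real_derivative - (p x * y x)) (at x)"
    and y: "\<And>x. a \<le> x \<Longrightarrow> x < 1 \<Longrightarrow> 0 < y x" "\<And>x. a \<le> x \<Longrightarrow> x < 1 \<Longrightarrow> y x \<le> K * (1 - x)"
    and pq: "\<And>x. a \<le> x \<Longrightarrow> x < 1 \<Longrightarrow> p x \<le> q x" "p a < q a"
    and init: "u a = y a" "u' a = y' a"
  obtains b where "a < b" "b < 1" "u b = 0" "u' b < 0"
proof -
  define W where "W = (\<lambda>x. u' x * y x - u x * y' x)"
  have dW: "(W has_real_derivative (p x - q x) * (u x * y x)) (at x)" if "a \<le> x" "x < 1" for x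
    unfolding W_def using du[OF that] du'[OF that] dy[OF that] dy'[OF that]
    by (auto intro!: derivative_eq_intros simp: algebra_simps)
  have W_anti: "W d \<le> W c" if "a \<le> c" "c \<le> d" "d < 1" "\<And>x. a \<le> x \<Longrightarrow> x < d \<Longrightarrow> 0 < u x" for c d
  proof (rule DERIV_nonpos_imp_decreasing_open[OF that(2)])
    show "continuous_on {c..d} W"
      using that by (intro continuous_at_imp_continuous_on ballI DERIV_isCont[OF dW]) auto
    fix x assume x: "c < x" "x < d"
    with that have x': "a \<le> x" "x < 1" by auto
    have "(p x - q x) * (u x * y x) \<le> 0"
      using pq(1)[OF x'] y(1)[OF x'] that(4)[of x] x x' by (intro mult_nonpos_nonneg) auto
    then show "\<exists>D. (W has_real_derivative D) (at x) \<and> D \<le> 0" using dW[OF x'] by blast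
  qed
  have "W a = 0" by (simp add: W_def init)
  have "(p a - q a) * (u a * y a) < 0"
    using pq(2) y(1)[of a] a by (simp add: init mult_less_0_iff)
  from DERIV_neg_dec_right[OF dW[OF order_refl a] this] obtain e where
    e: "0 < e" "\<And>h. 0 < h \<Longrightarrow> h < e \<Longrightarrow> W (a + h) < 0"
    using \<open>W a = 0\<close> by auto
  have W_neg: "W c < 0" if "a < c" "c < 1" "\<And>x. a \<le> x \<Longrightarrow> x < c \<Longrightarrow> 0 < u x" for c
  proof -
    define h where "h = min (e / 2) (c - a)"
    have h: "0 < h" "h < e" "a + h \<le> c" using e that by (auto simp: h_def)
    have "W c \<le> W (a + h)" using h that by (intro W_anti) auto
    with e(2)[OF h(1,2)] show ?thesis by simp
  qed
  have "\<exists>x. a \<le> x \<and> x < 1 \<and> u x \<le> 0"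
  proof (rule ccontr)
    assume "\<not> ?thesis"
    then have pos: "0 < u x" if "a \<le> x" "x < 1" for x using that by force
    define c where "c = (a + 1) / 2"
    have c: "a < c" "c < 1" using a by (auto simp: c_def)
    define m where "m = - W c / K\<^sup>2"
    have "0 < K * (1 - a)" using y[OF order_refl a] by simp
    then have K: "0 < K" using a by (simp add: zero_less_mult_iff)
    have Wc: "W c < 0" using W_neg[OF c] pos c by simp
    then have m: "0 < m" using K unfolding m_def by (intro divide_pos_pos) auto
    \<comment> \<open>The summand \<open>m / (1 - x)\<close> is a primitive of the divergent lower bound for \<open>- W / y\<^sup>2\<close>, so \<open>g\<close> decreases.\<close>
    define g where "g = (\<lambda>x. u x / y x + m / (1 - x))"
    \<comment> \<open>Close enough to \<open>1\<close> for \<open>m / (1 - x)\<close> to exceed \<open>g c\<close>.\<close>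
    define x where "x = max c (1 - m / (\<bar>g c\<bar> + 1))"
    have "0 < m / (\<bar>g c\<bar> + 1)" using m by (simp add: divide_pos_pos add_nonneg_pos)
    then have x: "c \<le> x" "x < 1" using c by (auto simp: x_def)
    have "g x \<le> g c"
    proof (rule DERIV_nonpos_imp_nonincreasing[OF x(1)])
      fix t assume t: "c \<le> t" "t \<le> x"
      with x c have t': "a \<le> t" "t < 1" by auto
      have yt: "0 < y t" "y t \<le> K * (1 - t)" using y[OF t'] by auto
      have "(g has_real_derivative (W t / (y t)\<^sup>2 + m / (1 - t)\<^sup>2)) (at t)"
        unfolding g_def W_def using du[OF t'] dy[OF t'] yt t'
        by (auto intro!: derivative_eq_intros simp: power2_eq_square)
      moreover have "W t / (y t)\<^sup>2 + m / (1 - t)\<^sup>2 \<le> 0"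
      proof -
        have "W t \<le> W c" using t t' c pos by (intro W_anti) auto
        have "(y t)\<^sup>2 \<le> (K * (1 - t))\<^sup>2" using yt by (intro power_mono) auto
        then have "m / (1 - t)\<^sup>2 \<le> - W c / (y t)\<^sup>2"
          using Wc yt t' K unfolding m_def divide_divide_eq_left power_mult_distrib
          by (intro divide_left_mono) auto
        also have "\<dots> \<le> - W t / (y t)\<^sup>2" using \<open>W t \<le> W c\<close> by (intro divide_right_mono) auto
        finally show ?thesis by simp
      qed
      ultimately show "\<exists>D. (g has_real_derivative D) (at t) \<and> D \<le> 0" by blast
    qed
    moreover have "\<bar>g c\<bar> + 1 \<le> m / (1 - x)"
    proof -
      have "1 - x \<le> m / (\<bar>g c\<bar> + 1)" by (simp add: x_def)
      then have "(1 - x) * (\<bar>g c\<bar> + 1) \<le> m" by (subst (asm) pos_le_divide_eq) auto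
      then show ?thesis using x by (simp add: pos_le_divide_eq mult.commute)
    qed
    moreover have "0 < u x / y x" using pos y x c by simp
    ultimately show False unfolding g_def by linarith
  qed
  then obtain x0 where x0: "a \<le> x0" "x0 < 1" "u x0 \<le> 0" by blast
  have cont: "continuous_on {a..d} u" if "d < 1" for d
    using that by (intro continuous_at_imp_continuous_on ballI DERIV_isCont[OF du]) auto
  define Z where "Z = {x \<in> {a..x0}. u x \<le> 0}"
  have "Z = {a..x0} \<inter> u -` {..0}" by (auto simp: Z_def)
  then have "closed Z"
    using continuous_closed_preimage[OF cont[OF x0(2)] closed_atLeastAtMost closed_atMost] by simp
  moreover have "bounded Z"
    by (rule bounded_subset[OF bounded_closed_interval[of a x0]]) (auto simp: Z_def)
  ultimately have "compact Z" by (simp add: compact_eq_bounded_closed)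
  moreover have "x0 \<in> Z" using x0 by (simp add: Z_def)
  ultimately obtain b where b: "b \<in> Z" "\<And>x. x \<in> Z \<Longrightarrow> b \<le> x"
    using compact_attains_inf[of Z] by blast
  have ub: "a \<le> b" "b < 1" "u b \<le> 0" using b(1) x0(2) by (auto simp: Z_def)
  have "0 < u a" using y(1)[OF order_refl a] by (simp add: init)
  have pos: "0 < u x" if "a \<le> x" "x < b" for x
    using b that by (fastforce simp: Z_def)
  obtain z where z: "a \<le> z" "z \<le> b" "u z = 0"
    using IVT2'[of u b 0 a] ub \<open>0 < u a\<close> cont[OF ub(2)] by auto
  then have "u b = 0" using pos[of z] by (cases "z = b") auto
  have "a < b" using ub \<open>u b = 0\<close> \<open>0 < u a\<close> by (cases "a = b") auto
  from W_neg[OF this ub(2) pos] have "u' b * y b < 0" by (simp add: W_def \<open>u b = 0\<close>)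
  then have "u' b < 0" using y(1)[of b] ub by (simp add: mult_less_0_iff)
  with \<open>a < b\<close> ub(2) \<open>u b = 0\<close> show thesis using that by blast
qed

section \<open>Linearization of the Schwarzian\<close>

lemma locally_univalent_on_holomorphic:
  assumes "open S" "locally_univalent_on f S"
  shows "f holomorphic_on S" "\<And>z. z \<in> S \<Longrightarrow> deriv f z \<noteq> 0"
proof -
  show hol: "f holomorphic_on S"
    using assms by (simp add: locally_univalent_on_def analytic_on_open)
  fix z assume "z \<in> S"
  then obtain U where "open U" "z \<in> U" "U \<subseteq> S" "inj_on f U"
    using assms by (auto simp: locally_univalent_on_def)
  then show "deriv f z \<noteq> 0"
    using holomorphic_injective_imp_regular holomorphic_on_subset[OF hol] by blast
qed

text \<open>
  Take \<open>r\<close> a holomorphic branch of \<open>1 / sqrt f'\<close>. Differentiating \<open>r\<^sup>2 f' = 1\<close> gives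
  \<open>r' = - (f'' / f') r / 2\<close>, and differentiating this once more produces the Schwarzian.
\<close>
lemma schwarzian_linearization:
  assumes S: "open S" "contractible S" and f: "locally_univalent_on f S"
  obtains r where "r holomorphic_on S" "\<And>z. z \<in> S \<Longrightarrow> r z \<noteq> 0"
    "\<And>z. z \<in> S \<Longrightarrow> 2 * deriv f z * deriv r z + deriv (deriv f) z * r z = 0"
    "\<And>z. z \<in> S \<Longrightarrow> deriv (deriv r) z = - (schwarzian f z / 2 * r z)"
proof -
  note hol = locally_univalent_on_holomorphic(1)[OF S(1) f]
  note nz = locally_univalent_on_holomorphic(2)[OF S(1) f]
  have hol': "deriv f holomorphic_on S" and hol'': "deriv (deriv f) holomorphic_on S"
    using hol S by (auto intro: holomorphic_deriv)
  have "(\<lambda>z. inverse (deriv f z)) holomorphic_on S"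
    using hol' nz by (rule holomorphic_on_inverse)
  then obtain r where r: "r holomorphic_on S" "\<And>z. z \<in> S \<Longrightarrow> inverse (deriv f z) = (r z)\<^sup>2"
    using contractible_imp_holomorphic_sqrt[OF _ S(2)] nz by (metis nonzero_imp_inverse_nonzero)
  have rnz: "r z \<noteq> 0" if "z \<in> S" for z using r(2)[OF that] nz[OF that] by auto
  note d = holomorphic_derivI[OF _ S(1)]
  have first: "2 * deriv f z * deriv r z + deriv (deriv f) z * r z = 0" if z: "z \<in> S" for z
  proof -
    have "((\<lambda>z. (r z)\<^sup>2 * deriv f z) has_field_derivative
        r z * (2 * deriv f z * deriv r z + deriv (deriv f) z * r z)) (at z)"
      by (rule derivative_eq_intros d[OF r(1) z] d[OF hol' z] refl)+
        (simp add: power2_eq_square algebra_simps)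
    moreover have "((\<lambda>z. (r z)\<^sup>2 * deriv f z) has_field_derivative 0) (at z)"
      by (rule has_field_derivative_transform_within_open[OF DERIV_const S(1) z, of 1])
        (use r(2) nz in \<open>simp flip: r(2)\<close>)
    ultimately show ?thesis using rnz[OF z] DERIV_unique by (metis mult_eq_0_iff)
  qed
  define h where "h = (\<lambda>z. deriv (deriv f) z / deriv f z)"
  have holh: "h holomorphic_on S" unfolding h_def using hol'' hol' nz by (rule holomorphic_on_divide)
  have r': "deriv r z = - (1/2) * (h z * r z)" if "z \<in> S" for z
    using first[OF that] nz[OF that] unfolding h_def by (simp add: field_simps add_eq_0_iff)
  have "deriv (deriv r) z = - (schwarzian f z / 2 * r z)" if z: "z \<in> S" for z
  proof (rule DERIV_imp_deriv)
    have "((\<lambda>z. - (1/2) * (h z * r z)) has_field_derivative - (1/2) * (deriv h z * r z + deriv r z * h z)) (at z)"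
      by (rule derivative_eq_intros d[OF r(1) z] d[OF holh z] refl)+ simp
    then have "(deriv r has_field_derivative - (1/2) * (deriv h z * r z + deriv r z * h z)) (at z)"
      by (rule has_field_derivative_transform_within_open[OF _ S(1) z]) (simp add: r')
    moreover have "- (1/2) * (deriv h z * r z + deriv r z * h z) = - (schwarzian f z / 2 * r z)"
      unfolding r'[OF z] schwarzian_def h_def[symmetric] by (simp add: h_def power2_eq_square field_simps)
    ultimately show "(deriv r has_field_derivative - (schwarzian f z / 2 * r z)) (at z)"
      by (rule DERIV_cong)
  qed
  with that r(1) rnz first show thesis by blast
qed

text \<open>
  The first-order relation between \<open>f\<close> and \<open>r\<close> makes the terms \<open>2 f' r' + f'' r\<close> in \<open>(f r)''\<close> cancel,
  so \<open>f r\<close> solves the same equation as \<open>r\<close>.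
\<close>
lemma linearization_solution:
  assumes S: "open S" "f holomorphic_on S" "r holomorphic_on S"
    and r: "\<And>z. z \<in> S \<Longrightarrow> 2 * deriv f z * deriv r z + deriv (deriv f) z * r z = 0"
    "\<And>z. z \<in> S \<Longrightarrow> deriv (deriv r) z = - (q z * r z)"
    and z: "z \<in> S"
  shows "((\<lambda>z. (a + b * f z) * r z) has_field_derivative
           (b * deriv f z * r z + (a + b * f z) * deriv r z)) (at z)"
    and "((\<lambda>z. b * deriv f z * r z + (a + b * f z) * deriv r z) has_field_derivative
           - (q z * ((a + b * f z) * r z))) (at z)"
proof -
  have hol: "deriv f holomorphic_on S" "deriv r holomorphic_on S"
    using S by (auto intro: holomorphic_deriv)
  note d = holomorphic_derivI[OF _ S(1) z]
  show "((\<lambda>z. (a + b * f z) * r z) has_field_derivative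
           (b * deriv f z * r z + (a + b * f z) * deriv r z)) (at z)"
    by (rule derivative_eq_intros d[OF S(2)] d[OF S(3)] refl)+ (simp add: algebra_simps)
  have "((\<lambda>z. b * deriv f z * r z + (a + b * f z) * deriv r z) has_field_derivative
      b * (2 * deriv f z * deriv r z + deriv (deriv f) z * r z) + (a + b * f z) * deriv (deriv r) z) (at z)"
    by (rule derivative_eq_intros d[OF S(2)] d[OF S(3)] d[OF hol(1)] d[OF hol(2)] refl)+
      (simp add: algebra_simps)
  then show "((\<lambda>z. b * deriv f z * r z + (a + b * f z) * deriv r z) has_field_derivative
           - (q z * ((a + b * f z) * r z))) (at z)"
    by (rule DERIV_cong) (simp only: r[OF z], simp add: algebra_simps)
qed

text \<open>
  For a Moebius map \<open>T\<close> the derivative is \<open>D / (c z + d)\<^sup>2\<close>, so \<open>c z + d\<close> is a multiple of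
  \<open>1 / sqrt T'\<close>. With this factor the first-order terms cancel and \<open>w o T\<close> satisfies an equation of
  the same form with potential \<open>q T'\<^sup>2\<close>; this is the invariance of the Schwarzian in the language of
  linear equations.
\<close>
lemma moebius_transformed_solution:
  fixes a b c d :: complex
  assumes D: "D = a * d - b * c" and T: "\<And>z. T z = (a * z + b) / (c * z + d)"
    and nz: "c * z + d \<noteq> 0"
    and w: "(w has_field_derivative w' (T z)) (at (T z))"
    and w': "(w' has_field_derivative - (q * w (T z))) (at (T z))"
  shows "((\<lambda>z. (c * z + d) * w (T z)) has_field_derivative
            (c * w (T z) + D / (c * z + d) * w' (T z))) (at z)"
    and "((\<lambda>z. c * w (T z) + D / (c * z + d) * w' (T z)) has_field_derivative
            - (q * (D / (c * z + d)\<^sup>2)\<^sup>2 * ((c * z + d) * w (T z)))) (at z)"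
proof -
  have "(T has_field_derivative (a * (c * z + d) - (a * z + b) * c) / ((c * z + d) * (c * z + d))) (at z)"
    unfolding T[abs_def] using nz by (auto intro!: derivative_eq_intros)
  then have dT: "(T has_field_derivative D / (c * z + d)\<^sup>2) (at z)"
    by (simp add: D power2_eq_square algebra_simps)
  have dl: "((\<lambda>z. c * z + d) has_field_derivative c) (at z)"
    by (auto intro!: derivative_eq_intros)
  note dw = DERIV_chain2[OF w dT] and dw' = DERIV_chain2[OF w' dT]
  show "((\<lambda>z. (c * z + d) * w (T z)) has_field_derivative
            (c * w (T z) + D / (c * z + d) * w' (T z))) (at z)"
  proof (rule DERIV_cong[OF DERIV_mult[OF dl dw]])
    have "x * (D / n\<^sup>2) * n = D / n * x" if "n \<noteq> 0" for x n :: complex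
      using that by (simp add: power2_eq_square)
    from this[OF nz] show "c * w (T z) + w' (T z) * (D / (c * z + d)\<^sup>2) * (c * z + d)
        = c * w (T z) + D / (c * z + d) * w' (T z)" by (simp only:)
  qed
  have dinv: "((\<lambda>z. D / (c * z + d)) has_field_derivative - (D * c / (c * z + d)\<^sup>2)) (at z)"
    using nz by (auto intro!: derivative_eq_intros simp: power2_eq_square field_simps)
  have "c * (x' * (D / n\<^sup>2)) + (- (D * c / n\<^sup>2) * x' + - (q * x) * (D / n\<^sup>2) * (D / n))
      = - (q * (D / n\<^sup>2)\<^sup>2 * (n * x))" if "n \<noteq> 0" for x x' n :: complex
    using that by (simp add: power2_eq_square field_simps)
  note eq = this[OF nz]
  show "((\<lambda>z. c * w (T z) + D / (c * z + d) * w' (T z)) has_field_derivative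
            - (q * (D / (c * z + d)\<^sup>2)\<^sup>2 * ((c * z + d) * w (T z)))) (at z)"
    by (rule DERIV_cong[OF DERIV_add[OF DERIV_cmult[OF dw] DERIV_mult[OF dinv dw']] eq])
qed

text \<open>
  The curves \<open>T ` (-1, 1)\<close> with \<open>T x = (x + i \<rho>) / (1 - i \<rho> x)\<close> are the geodesics symmetric about
  the imaginary axis, and they have the equation \<open>Im v * (1 + \<rho>\<^sup>2) = \<rho> * (1 + \<bar>v\<bar>\<^sup>2)\<close>. The map
  \<open>\<zeta> z = z / (1 + \<bar>z\<bar>\<^sup>2)\<close> straightens them to the horizontal chords \<open>Im \<zeta> = \<rho> / (1 + \<rho>\<^sup>2)\<close> of the disc
  of radius \<open>1/2\<close> (up to scale, the Klein model). So the rotation \<open>e\<close> is the direction of the chord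
  through \<open>\<zeta> z1\<close> and \<open>\<zeta> z2\<close>, and \<open>\<rho>\<close> is determined by its height \<open>h\<close>.
\<close>
lemma geodesic_through_two_points:
  fixes z1 z2 :: complex
  assumes "cmod z1 < 1" "cmod z2 < 1"
  obtains e :: complex and \<rho> x1 x2 :: real where "cmod e = 1" "\<bar>\<rho>\<bar> < 1" "\<bar>x1\<bar> < 1" "\<bar>x2\<bar> < 1"
    "z1 = e * (of_real x1 + \<i> * of_real \<rho>) / (1 - \<i> * of_real \<rho> * of_real x1)"
    "z2 = e * (of_real x2 + \<i> * of_real \<rho>) / (1 - \<i> * of_real \<rho> * of_real x2)"
proof -
  define \<zeta> where "\<zeta> = (\<lambda>z::complex. z / of_real (1 + (cmod z)\<^sup>2))"
  have pos: "0 < 1 + (cmod z)\<^sup>2" for z :: complex by (simp add: add_pos_nonneg)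
  \<comment> \<open>If the two images coincide, every chord through them will do.\<close>
  define e where "e = (if \<zeta> z1 = \<zeta> z2 then 1 else sgn (\<zeta> z1 - \<zeta> z2))"
  have e: "cmod e = 1" by (auto simp: e_def norm_sgn)
  have ee: "e * cnj e = 1" using complex_norm_square[of e] e by simp
  have same: "Im (\<zeta> z1 * cnj e) = Im (\<zeta> z2 * cnj e)"
  proof -
    have "(\<zeta> z1 - \<zeta> z2) * cnj e = of_real (cmod (\<zeta> z1 - \<zeta> z2))"
    proof (cases "\<zeta> z1 = \<zeta> z2")
      case False
      then have "\<zeta> z1 - \<zeta> z2 = of_real (cmod (\<zeta> z1 - \<zeta> z2)) * e"
        by (simp add: e_def sgn_eq)
      then show ?thesis using ee by (metis mult.assoc mult.right_neutral)
    qed simp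
    then have "Im ((\<zeta> z1 - \<zeta> z2) * cnj e) = 0" by (metis Im_complex_of_real)
    then show ?thesis by (simp add: algebra_simps)
  qed
  define h where "h = Im (\<zeta> z1 * cnj e)"
  have h: "\<bar>h\<bar> < 1/2"
  proof -
    have "\<bar>h\<bar> \<le> cmod (\<zeta> z1 * cnj e)" unfolding h_def by (rule abs_Im_le_cmod)
    also have "\<dots> = cmod z1 / (1 + (cmod z1)\<^sup>2)"
      using e pos[of z1] by (simp add: \<zeta>_def norm_mult norm_divide del: of_real_add)
    also have "\<dots> < 1/2"
    proof -
      have "0 < (1 - cmod z1)\<^sup>2" using assms by simp
      then show ?thesis using pos[of z1] by (simp add: field_simps power2_eq_square)
    qed
    finally show ?thesis .
  qed
  obtain \<rho> :: real where \<rho>: "\<bar>\<rho>\<bar> < 1" "\<rho> = h * (1 + \<rho>\<^sup>2)"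
  proof -
    have "\<exists>x\<ge>-1. x \<le> 1 \<and> x - h * (1 + x\<^sup>2) = 0"
      using h by (intro IVT) (auto intro!: continuous_intros simp: abs_less_iff)
    then obtain x where x: "-1 \<le> x" "x \<le> 1" "x = h * (1 + x\<^sup>2)" by auto
    have "x \<noteq> 1" "x \<noteq> -1" using x(3) h by auto
    with x that[of x] show thesis by (simp add: abs_less_iff)
  qed
  have denom: "1 - \<i> * of_real \<rho> * of_real x \<noteq> 0" for x :: real
    by (simp add: complex_eq_iff)
  have point: "\<exists>x. \<bar>x\<bar> < 1 \<and> z = e * (of_real x + \<i> * of_real \<rho>) / (1 - \<i> * of_real \<rho> * of_real x)"
    if z: "cmod z < 1" "Im (\<zeta> z * cnj e) = h" for z
  proof -
    define v where "v = z * cnj e"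
    have zv: "z = e * v" using ee by (simp add: v_def mult.left_commute)
    have cv: "cmod v < 1" using z e by (simp add: v_def norm_mult)
    have "\<zeta> z * cnj e = v / of_real (1 + (cmod v)\<^sup>2)" using e by (simp add: \<zeta>_def v_def norm_mult)
    with z(2) have "Im v / (1 + (cmod v)\<^sup>2) = h" by (simp del: of_real_add)
    then have "Im v = h * (1 + (cmod v)\<^sup>2)" using pos[of v] by (simp add: field_simps)
    with \<rho>(2) have geo: "Im v * (1 + \<rho>\<^sup>2) = \<rho> * (1 + (cmod v)\<^sup>2)" by (metis mult.assoc mult.commute)
    define k where "k = 1 + \<i> * of_real \<rho> * v"
    have "cmod (\<i> * of_real \<rho> * v) < 1"
      using \<rho>(1) cv by (simp add: norm_mult) (metis abs_ge_zero abs_norm_cancel mult_strict_mono' mult_1 norm_ge_zero)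
    then have k: "k \<noteq> 0" unfolding k_def by (metis add.commute add_eq_0_iff norm_minus_cancel norm_one less_irrefl)
    \<comment> \<open>The preimage of \<open>v\<close> under \<open>T\<close>; the equation of the geodesic says that it is real.\<close>
    define t where "t = (v - \<i> * of_real \<rho>) / k"
    have "Im ((v - \<i> * of_real \<rho>) * cnj k) = 0"
      using geo unfolding k_def cmod_power2 by (simp add: algebra_simps power2_eq_square)
    moreover have "t = (v - \<i> * of_real \<rho>) * cnj k / of_real ((cmod k)\<^sup>2)"
      using k by (simp add: t_def complex_norm_square field_simps del: of_real_power)
    ultimately have "Im t = 0" by (simp add: Im_divide_of_real del: of_real_power)
    then have t: "t = of_real (Re t)" by (simp add: complex_eq_iff)
    have num: "v - \<i> * of_real \<rho> = t * k" using k by (simp add: t_def)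
    then have "v * (1 - \<i> * of_real \<rho> * t) = t + \<i> * of_real \<rho>" by (simp add: k_def algebra_simps)
    then have v: "v = (t + \<i> * of_real \<rho>) / (1 - \<i> * of_real \<rho> * t)"
      using denom[of "Re t"] t by (simp add: field_simps)
    have "(cmod v)\<^sup>2 * (1 + \<rho>\<^sup>2 * (Re t)\<^sup>2) = (Re t)\<^sup>2 + \<rho>\<^sup>2"
    proof -
      have "(cmod v)\<^sup>2 * (cmod (1 - \<i> * of_real \<rho> * t))\<^sup>2 = (cmod (t + \<i> * of_real \<rho>))\<^sup>2"
        using \<open>v * _ = _\<close> by (metis norm_mult power_mult_distrib)
      then show ?thesis by (subst (asm) (1 2) t) (simp add: cmod_power2 power_mult_distrib)
    qed
    moreover have "(cmod v)\<^sup>2 < 1" using cv by (simp add: abs_square_less_1)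
    then have "(cmod v)\<^sup>2 * (1 + \<rho>\<^sup>2 * (Re t)\<^sup>2) < 1 * (1 + \<rho>\<^sup>2 * (Re t)\<^sup>2)"
      by (intro mult_strict_right_mono) (auto simp: add_pos_nonneg)
    ultimately have "0 < (1 - \<rho>\<^sup>2) * (1 - (Re t)\<^sup>2)" by (simp add: algebra_simps)
    moreover have "0 < 1 - \<rho>\<^sup>2" using \<rho>(1) by (simp add: abs_square_less_1)
    ultimately have "(Re t)\<^sup>2 < 1" by (simp add: zero_less_mult_iff)
    then have "\<bar>Re t\<bar> < 1" by (simp add: abs_square_less_1)
    with v t zv show ?thesis by (metis times_divide_eq_right)
  qed
  from point[OF assms(1)] point[OF assms(2)] same e \<rho>(1) that show thesis
    unfolding h_def by metis
qed

section \<open>General univalence and non-univalence criteria\<close>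

text \<open>
  Nehari's criterion. Along the geodesic \<open>T\<close> through two points with equal values, the pulled-back
  potential is \<open>(Sf o T) / 2 * T'\<^sup>2\<close>, and \<open>\<bar>T' x\<bar> = (1 - \<bar>T x\<bar>\<^sup>2) / (1 - x\<^sup>2)\<close>. As the point
  \<open>T 0\<close> of the geodesic is closest to the origin, \<open>\<bar>T x\<bar> \<ge> \<bar>x\<bar>\<close>, and the monotonicity of
  \<open>(1 - x\<^sup>2)\<^sup>2 p\<close> bounds the potential by \<open>p x\<close>. The function \<open>(f - f z1) r\<close>, transported to
  \<open>(-1, 1)\<close>, is a solution with two zeros.
\<close>
theorem univalent_if_schwarzian_below_riccati:
  fixes p k :: "real \<Rightarrow> real"
  assumes f: "locally_univalent_on f (ball 0 1)"
    and bound: "\<And>z. cmod z < 1 \<Longrightarrow> cmod (schwarzian f z) \<le> 2 * p (cmod z)"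
    and even: "\<And>x. p (- x) = p x"
    and anti: "\<And>x y. 0 \<le> x \<Longrightarrow> x \<le> y \<Longrightarrow> y < 1 \<Longrightarrow> (1 - y\<^sup>2)\<^sup>2 * p y \<le> (1 - x\<^sup>2)\<^sup>2 * p x"
    and riccati: "\<And>x. \<bar>x\<bar> < 1 \<Longrightarrow> (k has_real_derivative - p x - (k x)\<^sup>2) (at x)"
  shows "inj_on f (ball 0 1)"
proof (rule inj_onI, rule ccontr)
  fix z1 z2 :: complex
  assume "z1 \<in> ball 0 1" "z2 \<in> ball 0 1" and eq: "f z1 = f z2" and ne: "z1 \<noteq> z2"
  then have z: "cmod z1 < 1" "cmod z2 < 1" by auto
  obtain r where r: "r holomorphic_on ball 0 1" "\<And>z. z \<in> ball 0 1 \<Longrightarrow> r z \<noteq> 0"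
    "\<And>z. z \<in> ball 0 1 \<Longrightarrow> 2 * deriv f z * deriv r z + deriv (deriv f) z * r z = 0"
    "\<And>z. z \<in> ball 0 1 \<Longrightarrow> deriv (deriv r) z = - (schwarzian f z / 2 * r z)"
    using schwarzian_linearization[OF open_ball convex_imp_contractible[OF convex_ball] f] by blast
  note hol = locally_univalent_on_holomorphic(1)[OF open_ball f]
  obtain e :: complex and \<rho> x1 x2 :: real where e: "cmod e = 1" and \<rho>: "\<bar>\<rho>\<bar> < 1"
    and x12: "\<bar>x1\<bar> < 1" "\<bar>x2\<bar> < 1"
    and z12: "z1 = e * (of_real x1 + \<i> * of_real \<rho>) / (1 - \<i> * of_real \<rho> * of_real x1)"
    "z2 = e * (of_real x2 + \<i> * of_real \<rho>) / (1 - \<i> * of_real \<rho> * of_real x2)"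
    using geodesic_through_two_points[OF z] by blast
  define b c where "b = e * (\<i> * of_real \<rho>)" and "c = - (\<i> * of_real \<rho>)"
  define D where "D = e * 1 - b * c"
  define T where "T = (\<lambda>\<zeta>. (e * \<zeta> + b) / (c * \<zeta> + 1))"
  have T12: "z1 = T (of_real x1)" "z2 = T (of_real x2)"
    unfolding z12 T_def b_def c_def by (simp_all add: algebra_simps)
  have n2: "(cmod (c * of_real x + 1))\<^sup>2 = 1 + \<rho>\<^sup>2 * x\<^sup>2" for x :: real
    by (simp add: c_def cmod_power2 power_mult_distrib)
  have npos: "0 < 1 + \<rho>\<^sup>2 * x\<^sup>2" for x by (simp add: add_pos_nonneg)
  have nz: "c * of_real x + 1 \<noteq> 0" for x :: real
    using n2[of x] npos[of x] by auto
  have T2: "(cmod (T (of_real x)))\<^sup>2 = (x\<^sup>2 + \<rho>\<^sup>2) / (1 + \<rho>\<^sup>2 * x\<^sup>2)" for x :: real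
  proof -
    have "e * of_real x + b = e * (of_real x + \<i> * of_real \<rho>)" by (simp add: b_def algebra_simps)
    then have "(cmod (e * of_real x + b))\<^sup>2 = x\<^sup>2 + \<rho>\<^sup>2"
      using e by (simp add: norm_mult cmod_power2)
    then show ?thesis by (simp add: T_def norm_divide power_divide n2)
  qed
  have \<rho>2: "\<rho>\<^sup>2 < 1" using \<rho> by (simp add: abs_square_less_1)
  have Tx: "1 - (cmod (T (of_real x)))\<^sup>2 = (1 - \<rho>\<^sup>2) / (1 + \<rho>\<^sup>2 * x\<^sup>2) * (1 - x\<^sup>2)" for x :: real
    unfolding T2 using npos[of x] by (simp add: field_simps)
  have T1: "cmod (T (of_real x)) < 1" if "\<bar>x\<bar> < 1" for x :: real
  proof -
    have "x\<^sup>2 < 1" using that by (simp add: abs_square_less_1)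
    then have "0 < (1 - \<rho>\<^sup>2) / (1 + \<rho>\<^sup>2 * x\<^sup>2) * (1 - x\<^sup>2)"
      using \<rho>2 npos[of x] by (intro mult_pos_pos divide_pos_pos) auto
    then have "(cmod (T (of_real x)))\<^sup>2 < 1" using Tx[of x] by simp
    then show ?thesis by (simp add: abs_square_less_1)
  qed
  have Tge: "\<bar>x\<bar> \<le> cmod (T (of_real x))" if "\<bar>x\<bar> < 1" for x :: real
  proof -
    have "x\<^sup>2 < 1" using that by (simp add: abs_square_less_1)
    then have "x\<^sup>2 * x\<^sup>2 \<le> 1 * 1" by (intro mult_mono) auto
    then have "0 \<le> \<rho>\<^sup>2 * (1 - x\<^sup>2 * x\<^sup>2)" by (intro mult_nonneg_nonneg) auto
    then have "x\<^sup>2 * (1 + \<rho>\<^sup>2 * x\<^sup>2) \<le> x\<^sup>2 + \<rho>\<^sup>2" by (simp add: algebra_simps)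
    then have "\<bar>x\<bar>\<^sup>2 \<le> (cmod (T (of_real x)))\<^sup>2"
      unfolding T2 using npos[of x] by (simp add: pos_le_divide_eq)
    then show ?thesis by (rule power2_le_imp_le) simp
  qed
  define Q where "Q = (\<lambda>x::real. schwarzian f (T (of_real x)) / 2 * (D / (c * of_real x + 1)\<^sup>2)\<^sup>2)"
  have Q: "Re (Q x) \<le> p x" if x: "\<bar>x\<bar> < 1" for x
  proof -
    \<comment> \<open>The modulus of \<open>T' x\<close>.\<close>
    define m where "m = (1 - \<rho>\<^sup>2) / (1 + \<rho>\<^sup>2 * x\<^sup>2)"
    have "D = e * of_real (1 - \<rho>\<^sup>2)" by (simp add: D_def b_def c_def power2_eq_square algebra_simps)
    then have "cmod D = 1 - \<rho>\<^sup>2" using e \<rho>2 by (simp only: norm_mult norm_of_real) simp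
    then have m: "cmod (D / (c * of_real x + 1)\<^sup>2) = m"
      by (simp add: norm_divide norm_power n2 m_def)
    have "Re (Q x) \<le> cmod (Q x)" by (rule complex_Re_le_cmod)
    also have "\<dots> = cmod (schwarzian f (T (of_real x))) / 2 * m\<^sup>2"
      unfolding Q_def norm_mult norm_power m by (simp add: norm_divide)
    also have "\<dots> \<le> p (cmod (T (of_real x))) * m\<^sup>2"
      using bound[OF T1[OF x]] by (intro mult_right_mono) auto
    also have "\<dots> \<le> p \<bar>x\<bar>"
    proof -
      have "(1 - (cmod (T (of_real x)))\<^sup>2)\<^sup>2 * p (cmod (T (of_real x))) \<le> (1 - \<bar>x\<bar>\<^sup>2)\<^sup>2 * p \<bar>x\<bar>"
        using Tge[OF x] T1[OF x] by (intro anti) auto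
      then have "(1 - x\<^sup>2)\<^sup>2 * (p (cmod (T (of_real x))) * m\<^sup>2) \<le> (1 - x\<^sup>2)\<^sup>2 * p \<bar>x\<bar>"
        unfolding Tx m_def[symmetric] by (simp add: power_mult_distrib mult_ac)
      moreover have "0 < (1 - x\<^sup>2)\<^sup>2" using x abs_square_less_1[of x] by auto
      ultimately show ?thesis by (rule mult_left_le_imp_le)
    qed
    also have "\<dots> = p x" using even[of x] by (cases "0 \<le> x") auto
    finally show ?thesis .
  qed
  have contra: False if st: "\<bar>s\<bar> < 1" "\<bar>t\<bar> < 1" "s < t" and fst: "f (T (of_real s)) = f (T (of_real t))" for s t :: real
  proof -
    define w where "w = (\<lambda>z. (- f (T (of_real s)) + 1 * f z) * r z)"
    define w' where "w' = (\<lambda>z. 1 * deriv f z * r z + (- f (T (of_real s)) + 1 * f z) * deriv r z)"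
    define u where "u = (\<lambda>\<zeta>. (c * \<zeta> + 1) * w (T \<zeta>))"
    define u' where "u' = (\<lambda>\<zeta>. c * w (T \<zeta>) + D / (c * \<zeta> + 1) * w' (T \<zeta>))"
    have ode: "((\<lambda>x. u (of_real x)) has_vector_derivative u' (of_real x)) (at x)"
      "((\<lambda>x. u' (of_real x)) has_vector_derivative - (Q x * u (of_real x))) (at x)"
      if "\<bar>x\<bar> < 1" for x
    proof -
      have Tb: "T (of_real x) \<in> ball 0 1" using T1[OF that] by simp
      have lin: "(w has_field_derivative w' (T (of_real x))) (at (T (of_real x)))"
        "(w' has_field_derivative - (schwarzian f (T (of_real x)) / 2 * w (T (of_real x)))) (at (T (of_real x)))"
        unfolding w_def w'_def
        by (rule linearization_solution(1)[OF open_ball hol r(1,3,4) Tb],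
          assumption, assumption)
          (rule linearization_solution(2)[OF open_ball hol r(1,3,4) Tb])
      have D1: "D = e * 1 - b * c" and T1: "\<And>\<zeta>. T \<zeta> = (e * \<zeta> + b) / (c * \<zeta> + 1)"
        by (simp_all add: D_def T_def)
      note mt = moebius_transformed_solution[OF D1 T1 nz lin]
      show "((\<lambda>x. u (of_real x)) has_vector_derivative u' (of_real x)) (at x)"
        unfolding u_def u'_def by (rule has_vector_derivative_real_field[OF mt(1)])
      show "((\<lambda>x. u' (of_real x)) has_vector_derivative - (Q x * u (of_real x))) (at x)"
        unfolding u_def u'_def Q_def by (rule has_vector_derivative_real_field[OF mt(2)])
    qed
    have "u' (of_real s) = 0"
    proof (rule vanishing_twice_below_riccati[where u = "\<lambda>x. u (of_real x)" and u' = "\<lambda>x. u' (of_real x)" and b = t])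
      show "s < t" by fact
      show "u (of_real s) = 0" "u (of_real t) = 0" using fst by (simp_all add: u_def w_def)
      fix x assume "s \<le> x" "x \<le> t"
      then have x: "\<bar>x\<bar> < 1" using st by auto
      show "((\<lambda>x. u (of_real x)) has_vector_derivative u' (of_real x)) (at x)"
        "((\<lambda>x. u' (of_real x)) has_vector_derivative - (Q x * u (of_real x))) (at x)"
        "(k has_real_derivative - p x - (k x)\<^sup>2) (at x)" "Re (Q x) \<le> p x"
        using ode[OF x] riccati[OF x] Q[OF x] by auto
    qed
    moreover have "D \<noteq> 0"
    proof -
      have "D = e * of_real (1 - \<rho>\<^sup>2)" by (simp add: D_def b_def c_def power2_eq_square algebra_simps)
      moreover have "e \<noteq> 0" "1 - \<rho>\<^sup>2 \<noteq> 0" using e \<rho>2 by auto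
      ultimately show ?thesis by (simp del: of_real_diff)
    qed
    ultimately have "w' (T (of_real s)) = 0" using nz[of s] by (simp add: u'_def w_def)
    moreover have "T (of_real s) \<in> ball 0 1" using T1[OF st(1)] by simp
    ultimately show False
      using r(2) locally_univalent_on_holomorphic(2)[OF open_ball f] by (simp add: w'_def)
  qed
  have "x1 \<noteq> x2" using ne T12 by auto
  then consider "x1 < x2" | "x2 < x1" by linarith
  then show False using contra[of x1 x2] contra[of x2 x1] x12 eq T12 by cases auto
qed

text \<open>
  Since \<open>Sf\<close> is real on \<open>(-1, 1)\<close>, the real part \<open>u\<close> of a solution is again a solution. With the Cauchy
  data of \<open>y\<close> at \<open>x0\<close> it vanishes at some \<open>t > x0\<close> and, by reflection, at some \<open>s < x0\<close>. The solution
  \<open>w = (f - f s) r\<close> vanishes at \<open>s\<close> too, so the constant Wronskian of \<open>u\<close> and \<open>w\<close> is \<open>0\<close>; as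
  \<open>u' t < 0\<close>, also \<open>w t = 0\<close>, which means \<open>f t = f s\<close>.
\<close>
theorem not_univalent_if_schwarzian_above_extremal:
  fixes p y y' :: "real \<Rightarrow> real"
  assumes f: "locally_univalent_on f (ball 0 1)"
    and real: "\<And>x. \<bar>x\<bar> < 1 \<Longrightarrow> schwarzian f (of_real x) \<in> \<real>"
    and ge: "\<And>x. \<bar>x\<bar> < 1 \<Longrightarrow> 2 * p x \<le> Re (schwarzian f (of_real x))"
    and x0: "\<bar>x0\<bar> < 1" "2 * p x0 < Re (schwarzian f (of_real x0))"
    and y: "\<And>x. \<bar>x\<bar> < 1 \<Longrightarrow> (y has_real_derivative y' x) (at x)"
      "\<And>x. \<bar>x\<bar> < 1 \<Longrightarrow> (y' has_real_derivative - (p x * y x)) (at x)"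
      "\<And>x. \<bar>x\<bar> < 1 \<Longrightarrow> 0 < y x" "\<And>x. \<bar>x\<bar> < 1 \<Longrightarrow> y x \<le> K * (1 - \<bar>x\<bar>)"
  shows "\<not> inj_on f (ball 0 1)"
proof
  assume inj: "inj_on f (ball 0 1)"
  obtain r where r: "r holomorphic_on ball 0 1" "\<And>z. z \<in> ball 0 1 \<Longrightarrow> r z \<noteq> 0"
    "\<And>z. z \<in> ball 0 1 \<Longrightarrow> 2 * deriv f z * deriv r z + deriv (deriv f) z * r z = 0"
    "\<And>z. z \<in> ball 0 1 \<Longrightarrow> deriv (deriv r) z = - (schwarzian f z / 2 * r z)"
    using schwarzian_linearization[OF open_ball convex_imp_contractible[OF convex_ball] f] by blast
  note hol = locally_univalent_on_holomorphic(1)[OF open_ball f]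
  define q where "q = (\<lambda>x::real. Re (schwarzian f (of_real x)) / 2)"
  have q: "schwarzian f (of_real x) / 2 = of_real (q x)" if "\<bar>x\<bar> < 1" for x
    using real[OF that] by (auto simp: q_def elim!: Reals_cases)
  define S where "S = (\<lambda>a b z. (a + b * f z) * r z)"
  define S' where "S' = (\<lambda>a b z. b * deriv f z * r z + (a + b * f z) * deriv r z)"
  have ode: "((\<lambda>x. S a b (of_real x)) has_vector_derivative S' a b (of_real x)) (at x)"
    "((\<lambda>x. S' a b (of_real x)) has_vector_derivative - (of_real (q x) * S a b (of_real x))) (at x)"
    if x: "\<bar>x\<bar> < 1" for a b x
  proof -
    have xb: "complex_of_real x \<in> ball 0 1" using x by simp
    note lin = linearization_solution[OF open_ball hol r(1,3,4) xb, where a = a and b = b]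
    show "((\<lambda>x. S a b (of_real x)) has_vector_derivative S' a b (of_real x)) (at x)"
      unfolding S_def S'_def by (rule has_vector_derivative_real_field[OF lin(1)])
    show "((\<lambda>x. S' a b (of_real x)) has_vector_derivative - (of_real (q x) * S a b (of_real x))) (at x)"
      unfolding S_def S'_def q[OF x, symmetric] by (rule has_vector_derivative_real_field[OF lin(2)])
  qed
  have x0b: "complex_of_real x0 \<in> ball 0 1" using x0 by simp
  obtain a b where init: "S a b (of_real x0) = of_real (y x0)" "S' a b (of_real x0) = of_real (y' x0)"
  proof -
    define z where "z = complex_of_real x0"
    have nz: "r z \<noteq> 0" "deriv f z \<noteq> 0"
      using r(2) locally_univalent_on_holomorphic(2)[OF open_ball f] x0b by (auto simp: z_def)
    define s where "s = of_real (y x0) / r z"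
    define b where "b = (of_real (y' x0) - s * deriv r z) / (deriv f z * r z)"
    have "S (s - b * f z) b z = of_real (y x0)" "S' (s - b * f z) b z = of_real (y' x0)"
      using nz by (simp_all add: S_def S'_def s_def b_def)
    then show thesis using that by (auto simp: z_def)
  qed
  define u where "u = (\<lambda>x::real. Re (S a b (of_real x)))"
  define u' where "u' = (\<lambda>x::real. Re (S' a b (of_real x)))"
  have du: "(u has_real_derivative u' x) (at x)" "(u' has_real_derivative - (q x * u x)) (at x)"
    if "\<bar>x\<bar> < 1" for x
    using bounded_linear.has_vector_derivative[OF bounded_linear_Re ode(1)[OF that]]
      bounded_linear.has_vector_derivative[OF bounded_linear_Re ode(2)[OF that]]
    by (simp_all add: u_def u'_def has_real_derivative_iff_has_vector_derivative)
  have uy: "u x0 = y x0" "u' x0 = y' x0" by (simp_all add: u_def u'_def init)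
  have pq: "p x \<le> q x" if "\<bar>x\<bar> < 1" for x using ge[OF that] by (simp add: q_def)
  have pq0: "p x0 < q x0" using x0 by (simp add: q_def)
  obtain t where t: "x0 < t" "t < 1" "u t = 0" "u' t < 0"
  proof (rule solution_vanishes_before_endpoint[of x0 u u' q y y' p K])
    fix x assume "x0 \<le> x" "x < 1"
    then have x: "\<bar>x\<bar> < 1" using x0 by auto
    show "y x \<le> K * (1 - x)"
    proof -
      have "0 < K * (1 - \<bar>x\<bar>)" using y(3,4)[OF x] by linarith
      then have "0 < K" using x by (simp add: zero_less_mult_iff)
      then have "K * (1 - \<bar>x\<bar>) \<le> K * (1 - x)" by simp
      with y(4)[OF x] show ?thesis by simp
    qed
    show "(u has_real_derivative u' x) (at x)" "(u' has_real_derivative - (q x * u x)) (at x)"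
      "(y has_real_derivative y' x) (at x)" "(y' has_real_derivative - (p x * y x)) (at x)"
      "0 < y x" "p x \<le> q x"
      using du y pq x by auto
  qed (use uy pq0 x0 that in auto)
  obtain s' where s': "- x0 < s'" "s' < 1" "u (- s') = 0"
  proof (rule solution_vanishes_before_endpoint[of "- x0" "\<lambda>x. u (- x)" "\<lambda>x. - u' (- x)" "\<lambda>x. q (- x)"
        "\<lambda>x. y (- x)" "\<lambda>x. - y' (- x)" "\<lambda>x. p (- x)" K])
    fix x assume "- x0 \<le> x" "x < 1"
    then have x: "\<bar>- x\<bar> < 1" using x0 by auto
    show "y (- x) \<le> K * (1 - x)"
    proof -
      have "0 < K * (1 - \<bar>- x\<bar>)" using y(3,4)[OF x] by linarith
      then have "0 < K" using x by (simp add: zero_less_mult_iff)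
      then have "K * (1 - \<bar>- x\<bar>) \<le> K * (1 - x)" by simp
      with y(4)[OF x] show ?thesis by simp
    qed
    have refl: "((\<lambda>x. g (- x)) has_real_derivative - g') (at x)"
      if "(g has_real_derivative g') (at (- x))" for g g'
      using that by (simp add: DERIV_mirror)
    show "((\<lambda>x. u (- x)) has_real_derivative - u' (- x)) (at x)"
      "((\<lambda>x. y (- x)) has_real_derivative - y' (- x)) (at x)"
      using refl du(1)[OF x] y(1)[OF x] by auto
    show "((\<lambda>x. - u' (- x)) has_real_derivative - (q (- x) * u (- x))) (at x)"
      "((\<lambda>x. - y' (- x)) has_real_derivative - (p (- x) * y (- x))) (at x)"
      using DERIV_minus[OF refl[OF du(2)[OF x]]] DERIV_minus[OF refl[OF y(2)[OF x]]] by auto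
    show "0 < y (- x)" "p (- x) \<le> q (- x)"
      using y(3)[OF x] pq[OF x] by auto
  qed (use uy pq0 x0 that in auto)
  define s where "s = - s'"
  have s: "\<bar>s\<bar> < 1" "s < x0" "u s = 0" using s' x0 by (auto simp: s_def)
  define w where "w = (\<lambda>x::real. S (- f (of_real s)) 1 (of_real x))"
  define w' where "w' = (\<lambda>x::real. S' (- f (of_real s)) 1 (of_real x))"
  define G where "G = (\<lambda>x::real. of_real (u x) * w' x - of_real (u' x) * w x)"
  have "(G has_vector_derivative 0) (at x within {s..t})" if "x \<in> {s..t}" for x
  proof -
    have x: "\<bar>x\<bar> < 1" using that s t x0 by auto
    have dw: "(w has_vector_derivative w' x) (at x)"
      "(w' has_vector_derivative - (of_real (q x) * w x)) (at x)"
      using ode[OF x] by (simp_all add: w_def w'_def)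
    have duc: "((\<lambda>x. complex_of_real (u x)) has_vector_derivative of_real (u' x)) (at x)"
      "((\<lambda>x. complex_of_real (u' x)) has_vector_derivative of_real (- (q x * u x))) (at x)"
      using du[OF x] by (intro has_vector_derivative_of_real; simp)+
    have "(G has_vector_derivative 0) (at x)"
      unfolding G_def
      by (rule derivative_eq_intros has_vector_derivative_mult[OF duc(1) dw(2)]
        has_vector_derivative_mult[OF duc(2) dw(1)] refl)+ (simp add: algebra_simps)
    then show ?thesis by (rule has_vector_derivative_at_within)
  qed
  then obtain C where C: "\<And>x. x \<in> {s..t} \<Longrightarrow> G x = C"
    using has_vector_derivative_zero_constant[of "{s..t}" G] by auto
  have "w s = 0" by (simp add: w_def S_def)
  then have "G s = 0" using s by (simp add: G_def)
  then have "G t = 0" using C[of s] C[of t] s t by simp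
  then have "w t = 0" using t by (simp add: G_def)
  moreover have tb: "complex_of_real t \<in> ball 0 1" "complex_of_real s \<in> ball 0 1" using t s x0 by auto
  ultimately have "f (of_real t) = f (of_real s)" using r(2)[OF tb(1)] by (simp add: w_def S_def)
  then have "complex_of_real t = of_real s" using inj tb by (simp add: inj_on_eq_iff)
  then show False using s t by simp
qed

section \<open>The extremal solution\<close>

lemma schwarzian_holomorphic:
  assumes "open S" "locally_univalent_on f S"
  shows "schwarzian f holomorphic_on S"
  unfolding schwarzian_def
  using locally_univalent_on_holomorphic[OF assms] assms(1)
  by (intro holomorphic_intros holomorphic_deriv) auto

definition extremal_solution :: "real \<Rightarrow> real \<Rightarrow> real" where
  "extremal_solution l x = cos (pi * x / 2) * exp (- l * cos (pi * x / 2))"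

definition extremal_log_deriv :: "real \<Rightarrow> real \<Rightarrow> real" where
  "extremal_log_deriv l x = pi / 2 * (l * sin (pi * x / 2) - sin (pi * x / 2) / cos (pi * x / 2))"

lemma extremal_log_deriv_riccati:
  assumes x: "\<bar>x\<bar> < 1"
  shows "(extremal_log_deriv l has_real_derivative - nehari_p l x - (extremal_log_deriv l x)\<^sup>2) (at x)"
proof -
  define c s where "c = cos (pi * x / 2)" and "s = sin (pi * x / 2)"
  have c: "c \<noteq> 0" using cos_half_pi_pos[OF x] by (simp add: c_def)
  have s2: "s\<^sup>2 = 1 - c\<^sup>2" by (simp add: s_def c_def sin_squared_eq)
  have "(extremal_log_deriv l has_real_derivative
      pi / 2 * (l * (c * (pi / 2)) - (c * (pi / 2) * c + s * (s * (pi / 2))) / (c * c))) (at x)"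
    unfolding extremal_log_deriv_def c_def s_def
    by (rule derivative_eq_intros refl | use cos_half_pi_pos[OF x] in simp)+
  moreover have "pi / 2 * (l * (c * (pi / 2)) - (c * (pi / 2) * c + s * (s * (pi / 2))) / (c * c))
      = - nehari_p l x - (extremal_log_deriv l x)\<^sup>2"
  proof -
    have "(c * (pi / 2) * c + s * (s * (pi / 2))) / (c * c) = pi / 2 / c\<^sup>2"
    proof -
      have "(c * (pi / 2) * c + s * (s * (pi / 2))) / (c * c) = pi / 2 * (c\<^sup>2 + s\<^sup>2) / c\<^sup>2"
        by (simp add: power2_eq_square algebra_simps)
      then show ?thesis by (simp add: s2)
    qed
    moreover have "(extremal_log_deriv l x)\<^sup>2 = pi\<^sup>2 / 4 * (l\<^sup>2 * s\<^sup>2 - 2 * l * (s\<^sup>2 / c) + s\<^sup>2 / c\<^sup>2)"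
      unfolding extremal_log_deriv_def c_def[symmetric] s_def[symmetric]
      using c by (simp add: power2_eq_square field_simps)
    moreover have "s\<^sup>2 / c\<^sup>2 = 1 / c\<^sup>2 - 1" using c s2 by (simp add: diff_divide_distrib)
    ultimately show ?thesis
      unfolding nehari_p_real c_def[symmetric] s_def[symmetric]
      by (simp only:) (simp add: power2_eq_square algebra_simps)
  qed
  ultimately show ?thesis by (simp only:)
qed

lemma extremal_solution_pos: "\<bar>x\<bar> < 1 \<Longrightarrow> 0 < extremal_solution l x"
  using cos_half_pi_pos[of x] by (simp add: extremal_solution_def)

lemma extremal_solution_deriv:
  assumes x: "\<bar>x\<bar> < 1"
  shows "(extremal_solution l has_real_derivative extremal_log_deriv l x * extremal_solution l x) (at x)"
  unfolding extremal_solution_def extremal_log_deriv_def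
  using cos_half_pi_pos[OF x]
  by (auto intro!: derivative_eq_intros simp: field_simps)

lemma extremal_solution_deriv2:
  assumes x: "\<bar>x\<bar> < 1"
  shows "((\<lambda>x. extremal_log_deriv l x * extremal_solution l x) has_real_derivative
           - (nehari_p l x * extremal_solution l x)) (at x)"
  by (rule DERIV_cong[OF DERIV_mult[OF extremal_log_deriv_riccati[OF x] extremal_solution_deriv[OF x]]])
    (simp add: power2_eq_square algebra_simps)

text \<open>
  The linear decay at both ends makes the integral of \<open>1 / y\<^sup>2\<close> diverge, which sharpness rests on.
\<close>
lemma extremal_solution_le:
  assumes l: "0 \<le> l" and x: "\<bar>x\<bar> < 1"
  shows "extremal_solution l x \<le> pi / 2 * (1 - \<bar>x\<bar>)"
proof -
  have "cos (pi * x / 2) = cos \<bar>pi * x / 2\<bar>" by (simp only: cos_abs_real)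
  also have "\<bar>pi * x / 2\<bar> = pi * \<bar>x\<bar> / 2" by (simp add: abs_mult)
  also have "cos (pi * \<bar>x\<bar> / 2) = sin (pi / 2 * (1 - \<bar>x\<bar>))"
  proof -
    have "pi / 2 - pi / 2 * (1 - \<bar>x\<bar>) = pi * \<bar>x\<bar> / 2" by (simp add: field_simps)
    then show ?thesis by (simp only: sin_cos_eq of_real_eq_id id_apply)
  qed
  also have "\<dots> \<le> pi / 2 * (1 - \<bar>x\<bar>)" using x by (intro sin_x_le_x) auto
  finally have "cos (pi * x / 2) \<le> pi / 2 * (1 - \<bar>x\<bar>)" .
  moreover have "extremal_solution l x \<le> cos (pi * x / 2)"
    unfolding extremal_solution_def using cos_half_pi_pos[OF x] l
    by (intro mult_right_le_one_le) (auto intro!: mult_nonneg_nonneg)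
  ultimately show ?thesis by simp
qed

lemma nehari_p_even: "nehari_p l (- x) = (nehari_p l x :: real)"
  by (simp add: nehari_p_real)

theorem theorem5:
  fixes l :: real
  assumes "0 \<le> l" and "l \<le> lambda0"
  shows "self_majorant (nehari_p l) \<and>
    (\<forall>f. locally_univalent_on f (ball 0 1) \<longrightarrow>
       (\<forall>z\<in>ball 0 1. cmod (schwarzian f z) \<le> 2 * nehari_p l (cmod z)) \<longrightarrow>
       inj_on f (ball 0 1)) \<and>
    sharp_univalence_criterion (nehari_p l)"
proof (intro conjI allI impI)
  show "self_majorant (nehari_p l)" using assms by (rule self_majorant_nehari_p)
  fix f
  assume "locally_univalent_on f (ball 0 1)"
    and "\<forall>z\<in>ball 0 1. cmod (schwarzian f z) \<le> 2 * nehari_p l (cmod z)"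
  then show "inj_on f (ball 0 1)"
    by (intro univalent_if_schwarzian_below_riccati[where p = "nehari_p l" and k = "extremal_log_deriv l"]
        nehari_weight_antimono[OF assms] extremal_log_deriv_riccati nehari_p_even) auto
next
  show "sharp_univalence_criterion (nehari_p l)"
    unfolding sharp_univalence_criterion_def
  proof (intro allI impI)
    fix f
    assume f: "locally_univalent_on f (ball 0 1)"
      and above: "\<forall>x::real. -1 < x \<and> x < 1 \<longrightarrow> schwarzian f (of_real x) \<in> \<real> \<and>
           Re (schwarzian f (of_real x)) \<ge> 2 * Re (nehari_p l (of_real x))"
      and ne: "\<exists>z\<in>ball 0 1. schwarzian f z \<noteq> 2 * nehari_p l z"
    have ge: "2 * nehari_p l x \<le> Re (schwarzian f (of_real x))" and real: "schwarzian f (of_real x) \<in> \<real>"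
      if "\<bar>x\<bar> < 1" for x :: real
      using above that by (auto simp: nehari_p_of_real abs_less_iff)
    have "\<exists>x0::real. \<bar>x0\<bar> < 1 \<and> 2 * nehari_p l x0 < Re (schwarzian f (of_real x0))"
    proof (rule ccontr)
      assume no: "\<not> ?thesis"
      define U where "U = complex_of_real ` {-1<..<1}"
      have U: "U \<subseteq> ball 0 1" by (auto simp: U_def)
      have zero: "schwarzian f z - 2 * nehari_p l z = 0" if "z \<in> U" for z
      proof -
        obtain x where x: "z = of_real x" "\<bar>x\<bar> < 1" using \<open>z \<in> U\<close> by (auto simp: U_def)
        have "Re (schwarzian f (of_real x)) = 2 * nehari_p l x"
          using ge[OF x(2)] no x(2) by force
        then show ?thesis using real[OF x(2)] x(1)
          by (auto simp: nehari_p_of_real elim!: Reals_cases)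
      qed
      have "0 islimpt {-1<..<1::real}" by (simp add: islimpt_greaterThanLessThan1 open_real_greaterThanLessThan interior_limit_point interior_open)
      then have "of_real 0 islimpt U"
        unfolding U_def by (intro islimpt_isCont_image) (auto simp: eventually_at_filter)
      moreover have "(\<lambda>z. schwarzian f z - 2 * nehari_p l z) holomorphic_on ball 0 1"
        using schwarzian_holomorphic[OF open_ball f] self_majorant_nehari_p[OF assms]
        by (intro holomorphic_intros) (auto simp: self_majorant_def analytic_on_open)
      ultimately have "schwarzian f z - 2 * nehari_p l z = 0" if "z \<in> ball 0 1" for z
        using analytic_continuation[of "\<lambda>z. schwarzian f z - 2 * nehari_p l z" "ball 0 1" U 0 z] zero that U
        by auto
      with ne show False by auto
    qed
    then obtain x0 :: real where "\<bar>x0\<bar> < 1" "2 * nehari_p l x0 < Re (schwarzian f (of_real x0))"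
      by blast
    then show "\<not> inj_on f (ball 0 1)"
      by (intro not_univalent_if_schwarzian_above_extremal[where p = "nehari_p l" and ?x0.0 = x0 and K = "pi / 2"
            and y = "extremal_solution l" and y' = "\<lambda>x. extremal_log_deriv l x * extremal_solution l x"]
          f real ge extremal_solution_deriv extremal_solution_deriv2 extremal_solution_pos
          extremal_solution_le assms(1))
  qed
qed

end
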